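(* Let $m$ be odd, let $n=2^m-1$ and let $\beta$ be a primitive $n$-th root of unity in $\mathbb{F}_{2^m}$. Put $\delta=2^{\frac{m+1}{2}}-3$ and assume $\delta\ge 2$. Let $g(x)$ be the generator polynomial of the binary BCH code $\mathcal{C}_{(2,n,\delta,1,\beta)}$, let $h(x)=(x^n-1)/g(x)$, and let $g^\perp(x)=x^{\deg h(x)}h(x^{-1})/h(0)$ be the generator polynomial of $\mathcal{C}_{(2,n,\delta,1,\beta)}^\perp$. Let $\mathcal{C}'$ denote the cyclic code of length $2n$ over $\mathbb{F}_2$ with generator polynomial $g(x)g^\perp(x)$. Then $\mathcal{C}'$ is a Euclidean self-dual cyclic code with parameters $[2n,n,d]_2$, where $$d=\min\{2d(\mathcal{C}_{(2,n,\delta,1,\beta)}),\,d(\mathcal{C}_{(2,n,\delta,1,\beta)}^\perp)\}\ge 2^{\frac{m+1}{2}}.$$ In particular, in the case $m=5$ the minimum distance satisfies $d\ge 2^{\frac{m+1}{2}}+2=10$.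
   Context: An $[n,k,d]_q$ code is a $k$-dimensional linear subspace of $\mathbb{F}_q^n$ with minimum Hamming distance $d$; $d(\mathcal{C})$ denotes the minimum Hamming distance of $\mathcal{C}$. The Euclidean dual is $\mathcal{C}^\perp=\{c\in\mathbb{F}_q^n:\sum_i c_iy_i=0\ \forall y\in\mathcal{C}\}$; $\mathcal{C}$ is Euclidean self-dual if $\mathcal{C}=\mathcal{C}^\perp$. A cyclic code of length $N$ over $\mathbb{F}_q$ is identified with an ideal of $\mathbb{F}_q[x]/\langle x^N-1\rangle$ via $(c_0,\dots,c_{N-1})\mapsto c_0+c_1x+\dots+c_{N-1}x^{N-1}$; its generator polynomial is the unique monic divisor of $x^N-1$ generating it. For $\gcd(n,q)=1$ and $\beta$ a primitive $n$-th root of unity, $m_{\beta^i}(x)$ denotes the minimal polynomial of $\beta^i$ over $\mathbb{F}_q$. For integers $\delta\ge2$ and $b$, the BCH code $\mathcal{C}_{(q,n,\delta,b,\beta)}$ is the cyclic code of length $n$ over $\mathbb{F}_q$ with generator polynomial $\mathrm{lcm}\{m_{\beta^b}(x),\dots,m_{\beta^{b+\delta-2}}(x)\}$. *)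

theory Defs
  imports
    "HOL-Computational_Algebra.Computational_Algebra"
    "HOL-Algebra.Ideal"
    "HOL-Library.Cardinality"
    "Jordan_Normal_Form.VS_Connect"
begin

text \<open>
  Words of length \<open>N\<close> over a field are the elements of \<open>carrier_vec N\<close>. The field \<open>F\<^sub>q\<close> is a type
  \<open>'a\<close>; an extension field is a second type \<open>'b\<close> together with an embedding \<open>\<iota> :: 'a \<Rightarrow> 'b\<close>.
\<close>

subsection \<open>Linear codes\<close>

definition linear_code :: "nat \<Rightarrow> 'a::field vec set \<Rightarrow> bool" where
  "linear_code N C \<longleftrightarrow> subspace class_ring C (module_vec TYPE('a) N)"

definition code_dim :: "nat \<Rightarrow> 'a::field vec set \<Rightarrow> nat" where
  "code_dim N C = vectorspace.dim class_ring ((module_vec TYPE('a) N)\<lparr>carrier := C\<rparr>)"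

definition hamming_dist :: "'a vec \<Rightarrow> 'a vec \<Rightarrow> nat" where
  "hamming_dist u v = card {i. i < dim_vec u \<and> u $ i \<noteq> v $ i}"

text \<open>A code with fewer than two words gets the value \<open>0\<close>, the infimum of the empty set in \<open>nat\<close>.\<close>

definition min_dist :: "'a vec set \<Rightarrow> nat" where
  "min_dist C = Inf {hamming_dist u v | u v. u \<in> C \<and> v \<in> C \<and> u \<noteq> v}"

definition nkd_code :: "nat \<Rightarrow> nat \<Rightarrow> nat \<Rightarrow> 'a::field vec set \<Rightarrow> bool" where
  "nkd_code N k d C \<longleftrightarrow> linear_code N C \<and> code_dim N C = k \<and> min_dist C = d"

definition euclidean_dual :: "nat \<Rightarrow> 'a::field vec set \<Rightarrow> 'a vec set" where
  "euclidean_dual N C = {c \<in> carrier_vec N. \<forall>y\<in>C. c \<bullet> y = 0}"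

definition euclidean_self_dual :: "nat \<Rightarrow> 'a::field vec set \<Rightarrow> bool" where
  "euclidean_self_dual N C \<longleftrightarrow> C = euclidean_dual N C"

subsection \<open>Cyclic codes\<close>

abbreviation x_pow_minus_one :: "nat \<Rightarrow> 'a::field poly" where
  "x_pow_minus_one N \<equiv> monom 1 N - 1"

text \<open>The quotient ring \<open>F\<^sub>q[x]/\<langle>x\<^sup>N - 1\<rangle>\<close>, each class represented by its remainder.\<close>

definition cyc_ring :: "nat \<Rightarrow> 'a::field poly ring" where
  "cyc_ring N =
     \<lparr>carrier = range (\<lambda>p. p mod x_pow_minus_one N),
      mult = (\<lambda>p q. (p * q) mod x_pow_minus_one N),
      one = 1 mod x_pow_minus_one N,
      zero = 0,
      add = (+)\<rparr>"

definition word_poly :: "'a::field vec \<Rightarrow> 'a poly" where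
  "word_poly c = (\<Sum>i<dim_vec c. monom (c $ i) i)"

definition cyclic_code :: "nat \<Rightarrow> 'a::field vec set \<Rightarrow> bool" where
  "cyclic_code N C \<longleftrightarrow> C \<subseteq> carrier_vec N \<and> ideal (word_poly ` C) (cyc_ring N)"

definition is_generator_poly :: "nat \<Rightarrow> 'a::field vec set \<Rightarrow> 'a poly \<Rightarrow> bool" where
  "is_generator_poly N C g \<longleftrightarrow>
     C \<subseteq> carrier_vec N \<and> lead_coeff g = 1 \<and> g dvd x_pow_minus_one N \<and>
     word_poly ` C = PIdl\<^bsub>cyc_ring N\<^esub> (g mod x_pow_minus_one N)"

definition generator_poly :: "nat \<Rightarrow> 'a::field vec set \<Rightarrow> 'a poly" where
  "generator_poly N C = (THE g. is_generator_poly N C g)"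

definition cyclic_code_of :: "nat \<Rightarrow> 'a::field poly \<Rightarrow> 'a vec set" where
  "cyclic_code_of N g =
     {c \<in> carrier_vec N. word_poly c \<in> PIdl\<^bsub>cyc_ring N\<^esub> (g mod x_pow_minus_one N)}"

subsection \<open>BCH codes\<close>

definition primitive_root_of_unity :: "nat \<Rightarrow> 'b::field \<Rightarrow> bool" where
  "primitive_root_of_unity n \<beta> \<longleftrightarrow> n > 0 \<and> \<beta> ^ n = 1 \<and> (\<forall>k. 0 < k \<and> k < n \<longrightarrow> \<beta> ^ k \<noteq> 1)"

definition min_poly :: "('a::field \<Rightarrow> 'b::field) \<Rightarrow> 'b \<Rightarrow> 'a poly" where
  "min_poly \<iota> x = (THE p. lead_coeff p = 1 \<and> poly (map_poly \<iota> p) x = 0 \<and>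
     (\<forall>r. r \<noteq> 0 \<and> poly (map_poly \<iota> r) x = 0 \<longrightarrow> degree p \<le> degree r))"

text \<open>The class \<open>field_gcd\<close> supplies \<open>Lcm\<close> on polynomials, which is normalized: monic when nonzero.\<close>

definition bch_code ::
  "('a::field_gcd \<Rightarrow> 'b::field) \<Rightarrow> nat \<Rightarrow> nat \<Rightarrow> int \<Rightarrow> 'b \<Rightarrow> 'a vec set" where
  "bch_code \<iota> n \<delta> b \<beta> =
     cyclic_code_of n (Lcm ((\<lambda>i. min_poly \<iota> (\<beta> powi i)) ` {b .. b + int \<delta> - 2}))"

end

theory Submission
  imports Defs "Jordan_Normal_Form.Char_Poly"
begin

text \<open>
  Identify a code with the polynomials of degree less than \<open>N\<close> divisible by its generator \<open>g\<close>. If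
  \<open>g * h = x\<^sup>N - 1\<close>, then the dot product of two words is the coefficient of \<open>x\<^bsup>N - 1\<^esup>\<close> in the product
  of one polynomial with the reversal of the other, so the dual is generated by the reciprocal of
  \<open>h\<close>; for \<open>C'\<close> this reciprocal is \<open>g * gd\<close> again because \<open>x\<^bsup>2n\<^esup> - 1 = (x\<^sup>n - 1)\<^sup>2\<close>.

  Put \<open>k = (m + 1) / 2\<close>. The zeros of \<open>g\<close> are the \<open>\<beta>\<close>-powers with exponents \<open>i * 2\<^sup>s\<close>,
  \<open>1 \<le> i \<le> 2\<^sup>k - 4\<close>, and \<open>n\<close> never divides \<open>i * 2\<^sup>s + j\<close> for \<open>0 \<le> j \<le> 2\<^sup>k - 2\<close>. Hence
  \<open>\<beta>\<^sup>j\<close> is a zero of \<open>gd\<close> for all these \<open>j\<close>. This yields both \<open>g dvd gd\<close> (the dual is contained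
  in \<open>C\<close>) and, by the BCH bound, that the dual has distance at least \<open>2\<^sup>k\<close>.

  For a word \<open>c = A + x\<^sup>n B\<close> of \<open>C'\<close>, \<open>A + B\<close> lies in the dual of \<open>C\<close>, and if \<open>A + B = 0\<close> then
  \<open>B\<close> lies in \<open>C\<close>; so the weight of \<open>c\<close> is at least the claimed minimum. The two values are attained
  by \<open>(x\<^sup>n - 1) b\<close> with \<open>b\<close> in \<open>C\<close>, and by \<open>w\<^sup>2\<close> where \<open>w\<close> is a square root modulo \<open>x\<^sup>n - 1\<close> of a word
  of the dual.
\<close>

subsection \<open>Weights of polynomials\<close>

definition poly_weight :: "'a::zero poly \<Rightarrow> nat" where
  "poly_weight p = card {i. coeff p i \<noteq> 0}"

lemma finite_coeff_support: "finite {i. coeff p i \<noteq> 0}"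
  by (rule finite_subset[of _ "{..degree p}"]) (auto intro: le_degree)

lemma poly_weight_0 [simp]: "poly_weight 0 = 0"
  by (simp add: poly_weight_def)

lemma poly_weight_pCons:
  "poly_weight (pCons a p) = (if a = 0 then 0 else 1) + poly_weight p"
proof -
  have "{i. coeff (pCons a p) i \<noteq> 0} = (if a = 0 then {} else {0}) \<union> Suc ` {i. coeff p i \<noteq> 0}"
  proof (rule Set.set_eqI)
    fix i
    show "i \<in> {i. coeff (pCons a p) i \<noteq> 0} \<longleftrightarrow>
       i \<in> (if a = 0 then {} else {0}) \<union> Suc ` {i. coeff p i \<noteq> 0}"
      by (cases i) auto
  qed
  moreover have "card (Suc ` {i. coeff p i \<noteq> 0}) = card {i. coeff p i \<noteq> 0}"
    by (simp add: card_image)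
  ultimately show ?thesis
    unfolding poly_weight_def
    by (subst (asm) card_Un_disjoint[symmetric] | simp add: card_Un_disjoint finite_coeff_support)+
qed

lemma poly_weight_add_le: "poly_weight (p + q) \<le> poly_weight p + poly_weight q"
proof -
  have "card {i. coeff (p + q) i \<noteq> 0} \<le> card ({i. coeff p i \<noteq> 0} \<union> {i. coeff q i \<noteq> 0})"
    by (intro card_mono) (auto simp: finite_coeff_support)
  also have "\<dots> \<le> card {i. coeff p i \<noteq> 0} + card {i. coeff q i \<noteq> 0}"
    by (rule card_Un_le)
  finally show ?thesis by (simp add: poly_weight_def)
qed

lemma poly_weight_add_shift:
  fixes p q :: "'a::comm_semiring_1 poly"
  assumes "\<And>i. i \<ge> n \<Longrightarrow> coeff p i = 0"
  shows "poly_weight (p + monom 1 n * q) = poly_weight p + poly_weight q"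
proof -
  have "{i. coeff (p + monom 1 n * q) i \<noteq> 0} = {i. coeff p i \<noteq> 0} \<union> (\<lambda>i. i + n) ` {i. coeff q i \<noteq> 0}"
  proof (rule Set.set_eqI)
    fix i
    show "i \<in> {i. coeff (p + monom 1 n * q) i \<noteq> 0} \<longleftrightarrow>
       i \<in> {i. coeff p i \<noteq> 0} \<union> (\<lambda>i. i + n) ` {i. coeff q i \<noteq> 0}"
    proof (cases "i < n")
      case False
      then obtain j where "i = j + n" by (metis add.commute le_Suc_ex not_less)
      then show ?thesis using assms by (auto simp: coeff_monom_mult)
    qed (auto simp: coeff_monom_mult)
  qed
  moreover have "{i. coeff p i \<noteq> 0} \<inter> (\<lambda>i. i + n) ` {i. coeff q i \<noteq> 0} = {}"
    using assms by auto
  moreover have "card ((\<lambda>i. i + n) ` {i. coeff q i \<noteq> 0}) = card {i. coeff q i \<noteq> 0}"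
    by (rule card_image) (auto simp: inj_on_def)
  ultimately show ?thesis
    by (simp add: poly_weight_def card_Un_disjoint finite_coeff_support)
qed

lemma poly_cutoff_shift:
  fixes p :: "'a::comm_semiring_1 poly"
  shows "p = poly_cutoff n p + monom 1 n * poly_shift n p"
  by (rule poly_eqI) (simp add: coeff_poly_cutoff coeff_poly_shift coeff_monom_mult)

lemma poly_weight_cutoff_shift:
  fixes p :: "'a::comm_semiring_1 poly"
  shows "poly_weight p = poly_weight (poly_cutoff n p) + poly_weight (poly_shift n p)"
  by (subst poly_cutoff_shift[of p n], subst poly_weight_add_shift) (auto simp: coeff_poly_cutoff)

lemma degree_less_iff_coeff:
  fixes p :: "'a::zero poly"
  assumes "N > 0"
  shows "degree p < N \<longleftrightarrow> (\<forall>i\<ge>N. coeff p i = 0)"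
  using assms by (metis coeff_eq_0 degree_lessI leading_coeff_0_iff not_le order_less_le_trans degree_0)

lemma degree_poly_cutoff_less: "n > 0 \<Longrightarrow> degree (poly_cutoff n p) < n"
  by (simp add: degree_less_iff_coeff coeff_poly_cutoff)

lemma degree_poly_shift_less: "k > 0 \<Longrightarrow> degree p < k + n \<Longrightarrow> degree (poly_shift n p) < k"
  by (simp add: degree_less_iff_coeff coeff_poly_shift)

subsection \<open>The BCH bound\<close>

text \<open>Invertibility of a Vandermonde matrix, without determinants: a polynomial vanishing at
  every node except \<open>\<gamma> k\<close> isolates the unknown \<open>a k\<close>.\<close>

lemma power_sums_zero_imp_zero:
  fixes a \<gamma> :: "'i \<Rightarrow> 'b::field"
  assumes "finite S" "inj_on \<gamma> S" "\<And>l. l < card S \<Longrightarrow> (\<Sum>i\<in>S. a i * \<gamma> i ^ l) = 0" "k \<in> S"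
  shows "a k = 0"
proof -
  define p where "p = (\<Prod>i\<in>S-{k}. [:-\<gamma> i, 1:])"
  have "degree p = card (S - {k})"
    unfolding p_def by (subst degree_prod_eq_sum_degree) auto
  then have deg: "degree p < card S"
    using assms by (metis card_Diff1_less)
  have "(\<Sum>i\<in>S. a i * poly p (\<gamma> i)) = (\<Sum>i\<in>S. \<Sum>l\<le>degree p. coeff p l * (a i * \<gamma> i ^ l))"
    by (simp add: poly_altdef sum_distrib_left mult_ac)
  also have "\<dots> = (\<Sum>l\<le>degree p. coeff p l * (\<Sum>i\<in>S. a i * \<gamma> i ^ l))"
    by (subst sum.swap) (simp add: sum_distrib_left)
  also have "\<dots> = 0" using deg assms(3) by (intro sum.neutral) auto
  finally have "(\<Sum>i\<in>S. a i * poly p (\<gamma> i)) = 0" .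
  moreover have "(\<Sum>i\<in>S. a i * poly p (\<gamma> i)) = a k * poly p (\<gamma> k) + (\<Sum>i\<in>S-{k}. a i * poly p (\<gamma> i))"
    using assms by (simp add: sum.remove)
  moreover have "(\<Sum>i\<in>S-{k}. a i * poly p (\<gamma> i)) = 0"
    using assms(1) by (intro sum.neutral) (auto simp: p_def poly_prod)
  moreover have "poly p (\<gamma> k) \<noteq> 0"
    using assms(1,2,4) by (auto simp: p_def poly_prod inj_on_def)
  ultimately show ?thesis by simp
qed

text \<open>The nonzero coefficients solve a homogeneous Vandermonde system with nodes
  \<open>\<gamma> ^ i\<close>, \<open>i\<close> in the support. Were there at most \<open>t\<close>
  of them, the \<open>t\<close> zeros would force them to vanish. The offset \<open>\<zeta>\<close>
  merely rescales the unknowns.\<close>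

lemma bch_bound:
  fixes c :: "'b::field poly"
  assumes "c \<noteq> 0" "inj_on (\<lambda>i. \<gamma> ^ i) {..degree c}" "\<zeta> \<noteq> 0"
    and "\<And>l. l < t \<Longrightarrow> poly c (\<zeta> * \<gamma> ^ l) = 0"
  shows "t < poly_weight c"
proof (rule ccontr)
  define S where "S = {i. coeff c i \<noteq> 0}"
  assume "\<not> t < poly_weight c"
  then have le: "card S \<le> t" by (simp add: poly_weight_def S_def)
  have S: "finite S" "S \<subseteq> {..degree c}"
    unfolding S_def by (auto simp: finite_coeff_support intro: le_degree)
  have "(\<Sum>i\<in>S. (coeff c i * \<zeta> ^ i) * (\<gamma> ^ i) ^ l) = 0" if "l < card S" for l
  proof -
    have "poly c (\<zeta> * \<gamma> ^ l) = (\<Sum>i\<le>degree c. coeff c i * (\<zeta> * \<gamma> ^ l) ^ i)"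
      by (simp add: poly_altdef)
    also have "\<dots> = (\<Sum>i\<in>S. coeff c i * (\<zeta> * \<gamma> ^ l) ^ i)"
      using S by (intro sum.mono_neutral_right) (auto simp: S_def)
    also have "\<dots> = (\<Sum>i\<in>S. (coeff c i * \<zeta> ^ i) * (\<gamma> ^ i) ^ l)"
      by (intro sum.cong) (auto simp: power_mult_distrib mult_ac simp flip: power_mult)
    finally show ?thesis using assms(4)[of l] that le by simp
  qed
  moreover have "inj_on (\<lambda>i. \<gamma> ^ i) S"
    using assms(2) S(2) by (rule inj_on_subset)
  moreover have "degree c \<in> S" using assms(1) by (simp add: S_def)
  ultimately have "coeff c (degree c) * \<zeta> ^ degree c = 0"
    using S(1) by (intro power_sums_zero_imp_zero[of S "\<lambda>i. \<gamma> ^ i" "\<lambda>i. coeff c i * \<zeta> ^ i"])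
  then show False using assms by simp
qed

subsection \<open>Reduction modulo \<open>x\<^sup>N - 1\<close> and reversal\<close>

lemma degree_x_pow_minus_one [simp]: "degree (x_pow_minus_one N :: 'a::field poly) = N"
proof (cases "N = 0")
  case False
  have "coeff (x_pow_minus_one N :: 'a poly) N = 1" using False by simp
  moreover have "degree (x_pow_minus_one N :: 'a poly) \<le> N"
    by (rule degree_le) (auto)
  ultimately show ?thesis by (metis le_antisym le_degree zero_neq_one)
qed simp

lemma x_pow_minus_one_nonzero: "N > 0 \<Longrightarrow> x_pow_minus_one N \<noteq> (0 :: 'a::field poly)"
  by (metis degree_x_pow_minus_one degree_0 less_irrefl)

lemma reflect_x_pow_minus_one:
  "reflect_poly (x_pow_minus_one N :: 'a::field poly) = - x_pow_minus_one N"
  by (rule poly_eqI) (auto simp: coeff_reflect_poly)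

text \<open>Reduction folds the part of degree at least \<open>N\<close> onto the low part. Terms
  may merge or cancel there, but none are created.\<close>

lemma poly_weight_mod_x_pow_minus_one:
  fixes p :: "'a::field poly"
  assumes "N > 0"
  shows "poly_weight (p mod x_pow_minus_one N) \<le> poly_weight p"
proof (induction "degree p" arbitrary: p rule: less_induct)
  case less
  show ?case
  proof (cases "degree p < N")
    case True
    then show ?thesis by (simp add: mod_poly_less)
  next
    case False
    define A B where "A = poly_cutoff N p" and "B = poly_shift N p"
    have p: "p = (A + B) + x_pow_minus_one N * B"
      by (subst poly_cutoff_shift[of p N]) (simp add: A_def B_def algebra_simps)
    have "degree B < degree p"
      using False assms by (intro degree_poly_shift_less[of "degree p" p N, folded B_def]) auto
    moreover have "degree A < degree p"
      using degree_poly_cutoff_less[OF assms, of p] False by (simp add: A_def)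
    ultimately have "degree (A + B) < degree p"
      by (rule degree_add_less[rotated])
    then have "poly_weight ((A + B) mod x_pow_minus_one N) \<le> poly_weight (A + B)"
      by (rule less)
    also have "\<dots> \<le> poly_weight p"
      using poly_weight_add_le[of A B] poly_weight_cutoff_shift[of p N] by (simp add: A_def B_def)
    also have "(A + B) mod x_pow_minus_one N = p mod x_pow_minus_one N"
      by (subst p) simp
    finally show ?thesis .
  qed
qed

text \<open>The coefficient of \<open>x\<^sup>a\<close> in the product of \<open>reverse_to a c\<close> and \<open>y\<close> is the dot product of \<open>c\<close>
  and \<open>y\<close>.\<close>

definition reverse_to :: "nat \<Rightarrow> 'a::comm_semiring_1 poly \<Rightarrow> 'a poly" where
  "reverse_to a p = monom 1 (a - degree p) * reflect_poly p"

lemma coeff_reverse_to: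
  "degree p \<le> a \<Longrightarrow> coeff (reverse_to a p) i = (if i \<le> a then coeff p (a - i) else 0)"
  by (auto simp: reverse_to_def coeff_monom_mult coeff_reflect_poly coeff_eq_0)

lemma degree_reverse_to_le: "degree p \<le> a \<Longrightarrow> degree (reverse_to a p) \<le> a"
  by (rule degree_le) (auto simp: coeff_reverse_to)

lemma reverse_to_reverse_to: "degree p \<le> a \<Longrightarrow> reverse_to a (reverse_to a p) = p"
  by (rule poly_eqI) (auto simp: coeff_reverse_to degree_reverse_to_le coeff_eq_0)

lemma reverse_to_degree: "reverse_to (degree p) p = reflect_poly p"
  by (simp add: reverse_to_def)

lemma reverse_to_mult:
  fixes p q :: "'a::field poly"
  assumes "degree p \<le> a" "degree q \<le> b"
  shows "reverse_to (a + b) (p * q) = reverse_to a p * reverse_to b q"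
proof (cases "p = 0 \<or> q = 0")
  case False
  have "a + b - degree (p * q) = (a - degree p) + (b - degree q)"
    using False assms by (simp add: degree_mult_eq)
  moreover have "monom 1 ((a - degree p) + (b - degree q)) =
      monom 1 (a - degree p) * (monom 1 (b - degree q) :: 'a poly)"
    by (simp add: mult_monom)
  ultimately show ?thesis
    by (simp add: reverse_to_def reflect_poly_mult mult_ac)
qed (auto simp: reverse_to_def)

text \<open>Vanishing against all shifts of \<open>g\<close> means that \<open>c' * g\<close> is
  zero modulo \<open>x^N - 1\<close>, that is, \<open>h\<close> divides the reversed word
  \<open>c'\<close>. Reversing back gives the condition on \<open>c\<close>.\<close>

lemma orthogonal_multiples_iff_reflect_dvd:
  fixes c g h :: "'a::field poly"
  assumes N: "N > 0" and gh: "g * h = x_pow_minus_one N" and c: "degree c < N"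
  shows "(\<forall>y. degree y < N \<and> g dvd y \<longrightarrow> coeff (reverse_to (N - 1) c * y) (N - 1) = 0)
           \<longleftrightarrow> reflect_poly h dvd c" (is "?L \<longleftrightarrow> ?R")
proof
  define c' where "c' = reverse_to (N - 1) c"
  have c'c: "c = reverse_to (N - 1) c'"
    unfolding c'_def using c by (subst reverse_to_reverse_to) auto
  have deg_c': "degree c' \<le> N - 1" unfolding c'_def using c by (intro degree_reverse_to_le) auto
  have nz: "g \<noteq> 0" "h \<noteq> 0" using gh x_pow_minus_one_nonzero[OF N, where ?'a = 'a] by auto
  have deg_gh: "degree g + degree h = N"
    using gh nz by (metis degree_mult_eq degree_x_pow_minus_one)
  {
    assume L: ?L
    define lo hi where "lo = poly_cutoff N (c' * g)" and "hi = poly_shift N (c' * g)"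
    have eq: "c' * g = lo + monom 1 N * hi"
      unfolding lo_def hi_def by (rule poly_cutoff_shift)
    \<comment> \<open>Testing against the shift of \<open>g\<close> by \<open>N - 1 - e\<close>
      moves the coefficient at \<open>e\<close> to position \<open>N - 1\<close>.\<close>
    have A0: "coeff (c' * g) e = 0" if "degree g \<le> e" "e < N" for e
    proof -
      have "degree (monom 1 (N - 1 - e) * g) < N"
        using that nz by (subst degree_mult_eq) (auto simp: degree_monom_eq)
      then have "coeff (c' * (monom 1 (N - 1 - e) * g)) (N - 1) = 0"
        using L by (auto simp: c'_def)
      moreover have "c' * (monom 1 (N - 1 - e) * g) = monom 1 (N - 1 - e) * (c' * g)"
        by (simp add: mult_ac)
      moreover have "N - 1 - e \<le> N - 1" "N - 1 - (N - 1 - e) = e" using that by auto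
      ultimately show ?thesis by (metis coeff_monom_mult mult_1)
    qed
    have deg_A: "degree (c' * g) < N + degree g"
      using degree_mult_le[of c' g] deg_c' N by linarith
    \<comment> \<open>\<open>lo + hi\<close> is \<open>c' * g\<close> folded modulo
      \<open>x^N - 1\<close>. It has no terms from \<open>degree g\<close> upwards, yet is a
      multiple of \<open>g\<close>, so it is zero.\<close>
    have "coeff (lo + hi) e = 0" if "degree g \<le> e" for e
      using that A0[of e] deg_A by (auto simp: lo_def hi_def coeff_poly_cutoff coeff_poly_shift coeff_eq_0)
    moreover have "g dvd lo + hi"
    proof -
      have "lo + hi = c' * g - g * h * hi" unfolding gh using eq by (simp add: algebra_simps)
      then show ?thesis by simp
    qed
    ultimately have "lo + hi = 0"
      by (metis dvd_imp_degree_le leading_coeff_0_iff)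
    then have "c' * g = (g * h) * hi" unfolding gh using eq by (simp add: algebra_simps eq_neg_iff_add_eq_0)
    then have c'h: "c' = h * hi" using nz by (simp add: mult_ac)
    show ?R
    proof (cases "hi = 0")
      case True
      then show ?thesis using c'c c'h by (simp add: reverse_to_def)
    next
      case False
      then have "degree h + degree hi \<le> N - 1" using deg_c' nz by (simp add: c'h degree_mult_eq)
      then have "reverse_to (degree h + (N - 1 - degree h)) (h * hi) =
          reverse_to (degree h) h * reverse_to (N - 1 - degree h) hi"
        by (intro reverse_to_mult) auto
      moreover have "degree h + (N - 1 - degree h) = N - 1"
        using \<open>degree h + degree hi \<le> N - 1\<close> by simp
      ultimately have "c = reflect_poly h * reverse_to (N - 1 - degree h) hi"
        using c'c by (simp add: c'h reverse_to_degree)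
      then show ?thesis by simp
    qed
  }
  {
    assume ?R
    then obtain q where q: "c = reflect_poly h * q" by (rule dvdE)
    have "poly g 0 * poly h 0 = - 1"
      using N by (simp flip: poly_mult add: gh poly_monom)
    then have "coeff h 0 \<noteq> 0" by (auto simp: poly_0_coeff_0)
    then have refl: "degree (reflect_poly h) = degree h" "reflect_poly (reflect_poly h) = h"
      by (auto simp: degree_reflect_poly_eq)
    show ?L
    proof (intro allI impI)
      fix y assume y: "degree y < N \<and> g dvd y"
      then have "g dvd y" by simp
      then obtain r where r: "y = g * r" by (rule dvdE)
      show "coeff (reverse_to (N - 1) c * y) (N - 1) = 0"
      proof (cases "q = 0 \<or> r = 0")
        case True
        then show ?thesis by (auto simp: q r reverse_to_def)
      next
        case False
        have "degree h + degree q \<le> N - 1" using c q False nz refl by (simp add: degree_mult_eq)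
        then have "degree q \<le> N - 1 - degree h" "degree h + (N - 1 - degree h) = N - 1"
          by auto
        then have "c' = h * reverse_to (N - 1 - degree h) q"
          unfolding c'_def q using reverse_to_mult[of "reflect_poly h" "degree h" q "N - 1 - degree h"]
            reverse_to_degree[of "reflect_poly h"] by (simp only: refl order_refl)
        then have eq: "c' * y = x_pow_minus_one N * (reverse_to (N - 1 - degree h) q * r)" (is "_ = _ * ?s")
          by (simp add: r gh[symmetric] mult_ac)
        \<comment> \<open>The coefficient of the product at \<open>N - 1\<close> is minus this one.
          If nonzero, it would force degree at least \<open>2 * N - 1\<close>, too large for
          \<open>c' * y\<close>.\<close>
        have "coeff ?s (N - 1) = 0"
        proof (rule ccontr)
          assume s: "coeff ?s (N - 1) \<noteq> 0"
          then have "?s \<noteq> 0" by auto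
          then have "degree (c' * y) = N + degree ?s" unfolding eq
            using x_pow_minus_one_nonzero[OF N, where ?'a = 'a] by (subst degree_mult_eq) auto
          moreover have "degree (c' * y) \<le> (N - 1) + (N - 1)"
            using degree_mult_le[of c' y] deg_c' y by linarith
          moreover have "N - 1 \<le> degree ?s" using s by (rule le_degree)
          ultimately show False using N by linarith
        qed
        then show ?thesis
          using N unfolding c'_def[symmetric] eq left_diff_distrib
          by (simp add: coeff_monom_mult)
      qed
    qed
  }
qed

subsection \<open>Cyclic codes as sets of multiples\<close>

text \<open>Divisibility of the representative of degree below \<open>N\<close> replaces membership
  in a principal ideal of the quotient ring; the two agree when \<open>g\<close> divides
  \<open>x^N - 1\<close>.\<close>

definition poly_code :: "nat \<Rightarrow> 'a::field poly \<Rightarrow> 'a vec set" where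
  "poly_code N g = {c \<in> carrier_vec N. g dvd word_poly c}"

definition poly_word :: "nat \<Rightarrow> 'a::field poly \<Rightarrow> 'a vec" where
  "poly_word N p = vec N (coeff p)"

lemma coeff_word_poly: "coeff (word_poly c) i = (if i < dim_vec c then vec_index c i else 0)"
proof -
  have "coeff (word_poly c) i = (\<Sum>j<dim_vec c. if j = i then vec_index c j else 0)"
    by (simp add: word_poly_def coeff_sum)
  then show ?thesis by simp
qed

lemma poly_word_in_carrier [simp]: "poly_word N p \<in> carrier_vec N"
  by (simp add: poly_word_def)

text \<open>Phrased with coefficients instead of a degree bound in order to include
  \<open>N = 0\<close>.\<close>

lemma word_poly_poly_word: "(\<And>i. i \<ge> N \<Longrightarrow> coeff p i = 0) \<Longrightarrow> word_poly (poly_word N p) = p"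
  by (rule poly_eqI) (auto simp: coeff_word_poly poly_word_def)

lemma word_poly_poly_word': "degree p < N \<Longrightarrow> word_poly (poly_word N p) = p"
  by (rule word_poly_poly_word) (simp add: coeff_eq_0)

lemma poly_word_word_poly: "c \<in> carrier_vec N \<Longrightarrow> poly_word N (word_poly c) = c"
  by (rule eq_vecI) (auto simp: coeff_word_poly poly_word_def)

lemma degree_word_poly_less: "N > 0 \<Longrightarrow> c \<in> carrier_vec N \<Longrightarrow> degree (word_poly c) < N"
  by (auto simp: degree_less_iff_coeff coeff_word_poly)

lemma inj_on_word_poly: "inj_on word_poly (carrier_vec N)"
  by (metis inj_onI poly_word_word_poly)

lemma word_poly_image_poly_code:
  assumes "N > 0"
  shows "word_poly ` poly_code N g = {p. degree p < N \<and> g dvd p}"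
proof (intro Set.set_eqI iffI)
  fix p assume "p \<in> {p. degree p < N \<and> g dvd p}"
  then have "p = word_poly (poly_word N p)" "poly_word N p \<in> poly_code N g"
    by (auto simp: poly_code_def word_poly_poly_word')
  then show "p \<in> word_poly ` poly_code N g" by blast
qed (use assms in \<open>auto simp: poly_code_def degree_word_poly_less\<close>)

lemma carrier_cyc_ring:
  assumes "N > 0"
  shows "carrier (cyc_ring N :: 'a::field poly ring) = {p. degree p < N}"
proof -
  have "degree (p mod x_pow_minus_one N) < N" for p :: "'a poly"
    using degree_mod_less'[of "x_pow_minus_one N" p] assms x_pow_minus_one_nonzero[OF assms, where ?'a = 'a]
    by (cases "p mod x_pow_minus_one N = 0") auto
  moreover have "p = p mod x_pow_minus_one N" if "degree p < N" for p :: "'a poly"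
    using that by (simp add: mod_poly_less)
  ultimately show ?thesis
    unfolding cyc_ring_def by (auto intro: range_eqI)
qed

lemma cring_cyc_ring: "cring (cyc_ring N :: 'a::field poly ring)"
proof -
  let ?X = "x_pow_minus_one N :: 'a poly"
  show ?thesis
  proof (intro cringI abelian_groupI comm_monoidI)
    fix x assume x: "x \<in> carrier (cyc_ring N :: 'a poly ring)"
    then have "(- x) mod ?X \<in> carrier (cyc_ring N)" unfolding cyc_ring_def by (auto simp del: poly_mod_minus_left)
    moreover have "(- x) mod ?X + x = 0"
    proof -
      have "x = x mod ?X" using x by (auto simp: cyc_ring_def)
      then have "((- x) mod ?X + x) = ((- x) mod ?X + x mod ?X)" by simp
      also have "\<dots> = (- x + x) mod ?X" by (simp only: poly_mod_add_left)
      finally show ?thesis by simp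
    qed
    ultimately show "\<exists>y\<in>carrier (cyc_ring N). y \<oplus>\<^bsub>cyc_ring N\<^esub> x = \<zero>\<^bsub>cyc_ring N\<^esub>"
      by (intro bexI[of _ "(- x) mod ?X"]) (simp_all add: cyc_ring_def del: poly_mod_minus_left)
  qed (auto simp: cyc_ring_def algebra_simps mod_simps poly_mod_add_left[symmetric]
      intro: range_eqI[of _ _ 0])
qed

lemma cgenideal_cyc_ring:
  fixes g :: "'a::field poly"
  assumes N: "N > 0" and g: "g dvd x_pow_minus_one N"
  shows "PIdl\<^bsub>cyc_ring N\<^esub> (g mod x_pow_minus_one N) = {p. degree p < N \<and> g dvd p}"
proof (intro Set.set_eqI iffI)
  fix p assume p: "p \<in> {p. degree p < N \<and> g dvd p}"
  then obtain q where q: "p = q * g" by (auto simp: dvd_def mult.commute)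
  have "p = p mod x_pow_minus_one N" using p by (simp add: mod_poly_less)
  also have "\<dots> = (q mod x_pow_minus_one N) \<otimes>\<^bsub>cyc_ring N\<^esub> (g mod x_pow_minus_one N)"
    by (simp add: cyc_ring_def q mod_mult_eq)
  finally show "p \<in> PIdl\<^bsub>cyc_ring N\<^esub> (g mod x_pow_minus_one N)"
    by (auto simp: cgenideal_def cyc_ring_def)
next
  fix p assume "p \<in> PIdl\<^bsub>cyc_ring N\<^esub> (g mod x_pow_minus_one N)"
  then obtain q where q: "p = (q * (g mod x_pow_minus_one N)) mod x_pow_minus_one N"
    by (auto simp: cgenideal_def cyc_ring_def)
  then have "p \<in> carrier (cyc_ring N)" by (simp add: cyc_ring_def)
  moreover have "g dvd p" unfolding q using g by (simp add: dvd_mod_iff)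
  ultimately show "p \<in> {p. degree p < N \<and> g dvd p}" using carrier_cyc_ring[OF N] by auto
qed

lemma cyclic_code_of_eq_poly_code:
  assumes "N > 0" "g dvd x_pow_minus_one N"
  shows "cyclic_code_of N g = poly_code N g"
  unfolding cyclic_code_of_def cgenideal_cyc_ring[OF assms] poly_code_def
  using assms by (auto simp: degree_word_poly_less)

lemma is_generator_poly_iff:
  assumes N: "N > 0"
  shows "is_generator_poly N C g \<longleftrightarrow>
    lead_coeff g = 1 \<and> g dvd x_pow_minus_one N \<and> C = poly_code N g"
proof -
  have eq1: "C \<subseteq> carrier_vec N \<and> word_poly ` C = word_poly ` poly_code N g \<longleftrightarrow> C = poly_code N g"
    using inj_on_image_eq_iff[OF inj_on_word_poly, of C N "poly_code N g"]
    by (auto simp: poly_code_def)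
  have eq2: "PIdl\<^bsub>cyc_ring N\<^esub> (g mod x_pow_minus_one N) = word_poly ` poly_code N g"
    if "g dvd x_pow_minus_one N"
    using cgenideal_cyc_ring[OF N that] word_poly_image_poly_code[OF N, of g] by simp
  show ?thesis
    unfolding is_generator_poly_def using eq1 eq2 by metis
qed

text \<open>The inclusion is applied to the residue of \<open>g\<close>, because \<open>g\<close>
  itself may have degree \<open>N\<close> and then is not the polynomial of a word.\<close>

lemma poly_code_subset_imp_dvd:
  assumes N: "N > 0" and g': "g' dvd x_pow_minus_one N" and g: "g dvd x_pow_minus_one N"
    and sub: "poly_code N g \<subseteq> poly_code N g'"
  shows "g' dvd g"
proof -
  let ?r = "g mod x_pow_minus_one N"
  have "?r \<in> {p. degree p < N \<and> g dvd p}"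
    using carrier_cyc_ring[OF N] g by (auto simp: cyc_ring_def dvd_mod_iff)
  then have "?r \<in> word_poly ` poly_code N g'"
    using sub word_poly_image_poly_code[OF N, of g] by blast
  then have "g' dvd ?r" using word_poly_image_poly_code[OF N, of g'] by auto
  then show ?thesis using g' by (simp add: dvd_mod_iff)
qed

lemma generator_poly_poly_code:
  assumes N: "N > 0" and g: "g dvd x_pow_minus_one N" "lead_coeff g = 1"
  shows "generator_poly N (poly_code N g) = g"
  unfolding generator_poly_def
proof (rule the_equality)
  fix g' assume "is_generator_poly N (poly_code N g) g'"
  then have g': "g' dvd x_pow_minus_one N" "lead_coeff g' = 1" "poly_code N g = poly_code N g'"
    using is_generator_poly_iff[OF N] by auto
  then show "g' = g"
    using poly_code_subset_imp_dvd[OF N] g by (intro poly_dvd_antisym) auto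
qed (use is_generator_poly_iff[OF N] g in auto)

lemma cyclic_code_poly_code:
  assumes N: "N > 0" and g: "g dvd x_pow_minus_one N"
  shows "cyclic_code N (poly_code N g)"
proof -
  interpret cring "cyc_ring N :: 'a poly ring" by (rule cring_cyc_ring)
  have "g mod x_pow_minus_one N \<in> carrier (cyc_ring N)" by (simp add: cyc_ring_def)
  then show ?thesis
    unfolding cyclic_code_def word_poly_image_poly_code[OF N] cgenideal_cyc_ring[OF N g, symmetric]
    using cgenideal_ideal by (auto simp: poly_code_def)
qed

lemma word_poly_add: "dim_vec u = dim_vec v \<Longrightarrow> word_poly (u + v) = word_poly u + word_poly v"
  by (rule poly_eqI) (simp add: coeff_word_poly)

lemma word_poly_smult: "word_poly (a \<cdot>\<^sub>v v) = Polynomial.smult a (word_poly v)"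
  by (rule poly_eqI) (simp add: coeff_word_poly)

lemma word_poly_zero [simp]: "word_poly (0\<^sub>v N) = 0"
  by (rule poly_eqI) (simp add: coeff_word_poly)

lemma linear_code_poly_code: "linear_code N (poly_code N g)"
  unfolding linear_code_def
proof (rule subspace.intro[OF vec_vs])
  interpret vectorspace class_ring "module_vec TYPE('a) N" by (rule vec_vs)
  show "submodule class_ring (poly_code N g) (module_vec TYPE('a) N)"
    by unfold_locales
      (auto simp: poly_code_def module_vec_simps word_poly_add word_poly_smult dvd_smult)
qed

text \<open>Multiplication by \<open>g\<close> is an injective linear map from the words of length
  \<open>N - degree g\<close> onto the code; rank-nullity does the rest.\<close>

lemma code_dim_poly_code:
  fixes g :: "'a::field poly"
  assumes N: "N > 0" and g: "g \<noteq> 0" "degree g \<le> N"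
  shows "code_dim N (poly_code N g) = N - degree g"
proof -
  define k where "k = N - degree g"
  define T where "T = (\<lambda>v. poly_word N (g * word_poly v))"
  have small: "degree (g * word_poly v) < N \<or> word_poly v = 0" if "v \<in> carrier_vec k" for v
  proof (cases "k > 0 \<and> word_poly v \<noteq> 0")
    case True
    then have "degree (word_poly v) < k" using that by (simp add: degree_word_poly_less)
    then show ?thesis using True g by (simp add: degree_mult_eq k_def)
  next
    case False
    moreover have "word_poly v = 0" if "k = 0"
      using that \<open>v \<in> carrier_vec k\<close> by (simp add: word_poly_def)
    ultimately show ?thesis by auto
  qed
  have wT: "word_poly (T v) = g * word_poly v" if "v \<in> carrier_vec k" for v
    using small[OF that] N unfolding T_def by (auto intro!: word_poly_poly_word')
  have inj: "inj_on T (carrier_vec k)"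
  proof (rule inj_onI)
    fix u v assume uv: "u \<in> carrier_vec k" "v \<in> carrier_vec k" "T u = T v"
    then have "g * word_poly u = g * word_poly v" using wT by metis
    then show "u = v" using g uv inj_on_word_poly[of k] by (auto simp: inj_on_def)
  qed
  have im: "T ` carrier_vec k = poly_code N g"
  proof (intro Set.set_eqI iffI)
    fix c assume c: "c \<in> poly_code N g"
    then have "g dvd word_poly c" by (simp add: poly_code_def)
    then obtain q where q: "word_poly c = g * q" by (rule dvdE)
    have "coeff q i = 0" if "i \<ge> k" for i
    proof (cases "q = 0")
      case False
      then have "degree g + degree q < N"
        using c g N degree_word_poly_less[of N c] by (simp add: q poly_code_def degree_mult_eq)
      then show ?thesis using that by (intro coeff_eq_0) (simp add: k_def)
    qed simp
    then have "word_poly (poly_word k q) = q" by (rule word_poly_poly_word)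
    then have "T (poly_word k q) = c"
      using c by (simp add: T_def poly_code_def poly_word_word_poly flip: q)
    then show "c \<in> T ` carrier_vec k" by (metis imageI poly_word_in_carrier)
  next
    fix c assume "c \<in> T ` carrier_vec k"
    then show "c \<in> poly_code N g"
      using wT by (auto simp: poly_code_def) (simp add: T_def)
  qed
  interpret V: vec_space "TYPE('a)" k .
  interpret W: vec_space "TYPE('a)" N .
  have hom: "T \<in> module_hom class_ring (module_vec TYPE('a) k) (module_vec TYPE('a) N)"
  proof -
    have "T (u + v) = T u + T v" if "u \<in> carrier_vec k" "v \<in> carrier_vec k" for u v
      using that by (intro eq_vecI) (auto simp: T_def poly_word_def word_poly_add algebra_simps)
    moreover have "T (a \<cdot>\<^sub>v v) = a \<cdot>\<^sub>v T v" for a v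
      by (intro eq_vecI) (auto simp: T_def poly_word_def word_poly_smult)
    moreover have "T v \<in> carrier_vec N" for v by (simp add: T_def)
    ultimately show ?thesis by (auto simp: module_hom_def module_vec_simps)
  qed
  interpret linear_map class_ring "module_vec TYPE('a) k" "module_vec TYPE('a) N" T
    by unfold_locales (rule hom)
  have "vectorspace.dim class_ring ((module_vec TYPE('a) N)\<lparr>carrier := imT\<rparr>) = k"
    using rank_nullity[OF V.fin_dim] inj_imp_dim_ker0 inj V.dim_is_n by (simp add: module_vec_simps)
  moreover have "imT = poly_code N g" unfolding im_def by (simp add: module_vec_simps im)
  ultimately show ?thesis by (simp add: code_dim_def k_def)
qed

lemma hamming_dist_eq_poly_weight:
  assumes "u \<in> carrier_vec N" "v \<in> carrier_vec N"
  shows "hamming_dist u v = poly_weight (word_poly u - word_poly v)"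
proof -
  have "{i. i < dim_vec u \<and> vec_index u i \<noteq> vec_index v i} = {i. coeff (word_poly u - word_poly v) i \<noteq> 0}"
    using assms by (auto simp: coeff_word_poly)
  then show ?thesis by (simp add: hamming_dist_def poly_weight_def)
qed

lemma min_dist_poly_code:
  assumes N: "N > 0"
  shows "min_dist (poly_code N g) = Inf (poly_weight ` {p. p \<noteq> 0 \<and> degree p < N \<and> g dvd p})"
proof -
  have "{hamming_dist u v | u v. u \<in> poly_code N g \<and> v \<in> poly_code N g \<and> u \<noteq> v} =
        poly_weight ` {p. p \<noteq> 0 \<and> degree p < N \<and> g dvd p}" (is "?A = ?B")
  proof (intro Set.set_eqI iffI)
    fix x assume "x \<in> ?A"
    then obtain u v where uv: "u \<in> poly_code N g" "v \<in> poly_code N g" "u \<noteq> v" "x = hamming_dist u v"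
      by auto
    then have "x = poly_weight (word_poly u - word_poly v)"
      by (auto simp: poly_code_def intro!: hamming_dist_eq_poly_weight)
    moreover have "word_poly u - word_poly v \<noteq> 0"
      using uv inj_on_word_poly[of N] by (auto simp: inj_on_def poly_code_def)
    moreover have "degree (word_poly u - word_poly v) < N"
      using uv N by (auto simp: poly_code_def intro!: degree_diff_less degree_word_poly_less)
    ultimately show "x \<in> ?B" using uv by (auto simp: poly_code_def)
  next
    fix x assume "x \<in> ?B"
    then obtain p where p: "x = poly_weight p" "p \<noteq> 0" "degree p < N" "g dvd p" by auto
    define u where "u = poly_word N p"
    have u: "word_poly u = p" "u \<in> poly_code N g"
      using p by (auto simp: u_def poly_code_def word_poly_poly_word')
    have "hamming_dist u (0\<^sub>v N) = x"
      using u p by (subst hamming_dist_eq_poly_weight[of _ N]) (auto simp: poly_code_def)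
    moreover have "0\<^sub>v N \<in> poly_code N g" by (simp add: poly_code_def)
    moreover have "u \<noteq> 0\<^sub>v N" using u p by auto
    ultimately show "x \<in> ?A" using u by blast
  qed
  then show ?thesis by (simp add: min_dist_def)
qed

lemma scalar_prod_eq_coeff:
  assumes N: "N > 0" and c: "c \<in> carrier_vec N" and y: "y \<in> carrier_vec N"
  shows "c \<bullet> y = coeff (reverse_to (N - 1) (word_poly c) * word_poly y) (N - 1)"
proof -
  have deg: "degree (word_poly c) \<le> N - 1" using degree_word_poly_less[OF N c] by simp
  have "coeff (word_poly y * reverse_to (N - 1) (word_poly c)) (N - 1) =
      (\<Sum>i\<le>N - 1. coeff (word_poly y) i * coeff (word_poly c) i)"
  proof (unfold coeff_mult, intro sum.cong refl)
    fix i assume "i \<in> {..N - 1}"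
    then have "N - 1 - i \<le> N - 1" "N - 1 - (N - 1 - i) = i" by auto
    then show "coeff (word_poly y) i * coeff (reverse_to (N - 1) (word_poly c)) (N - 1 - i) =
        coeff (word_poly y) i * coeff (word_poly c) i"
      by (simp only: coeff_reverse_to[OF deg] if_True)
  qed
  also have "\<dots> = (\<Sum>i\<in>{0..<N}. vec_index c i * vec_index y i)"
    using N c y by (intro sum.cong) (auto simp: coeff_word_poly)
  finally show ?thesis using y by (simp add: scalar_prod_def mult.commute)
qed

lemma euclidean_dual_poly_code:
  fixes g h :: "'a::field poly"
  assumes N: "N > 0" and gh: "g * h = x_pow_minus_one N"
  shows "euclidean_dual N (poly_code N g) = poly_code N (reflect_poly h)"
proof -
  have "(\<forall>y\<in>poly_code N g. c \<bullet> y = 0) \<longleftrightarrow> reflect_poly h dvd word_poly c" if c: "c \<in> carrier_vec N" for c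
  proof -
    have "(\<forall>y\<in>poly_code N g. c \<bullet> y = 0) \<longleftrightarrow>
      (\<forall>y\<in>poly_code N g. coeff (reverse_to (N - 1) (word_poly c) * word_poly y) (N - 1) = 0)"
      using scalar_prod_eq_coeff[OF N c] by (auto simp: poly_code_def)
    also have "\<dots> \<longleftrightarrow>
      (\<forall>p\<in>word_poly ` poly_code N g. coeff (reverse_to (N - 1) (word_poly c) * p) (N - 1) = 0)"
      by blast
    also have "\<dots> \<longleftrightarrow> reflect_poly h dvd word_poly c"
      unfolding word_poly_image_poly_code[OF N]
      using orthogonal_multiples_iff_reflect_dvd[OF N gh degree_word_poly_less[OF N c]] by auto
    finally show ?thesis .
  qed
  then show ?thesis by (auto simp: euclidean_dual_def poly_code_def)
qed

subsection \<open>Characteristic two\<close>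

lemma card_2_field_nonzero_eq_1:
  assumes "CARD('a::{finite, field}) = 2" "(x::'a) \<noteq> 0"
  shows "x = 1"
proof -
  have "{0, 1} = (UNIV :: 'a set)"
    using assms by (intro card_subset_eq) auto
  then show ?thesis using assms by blast
qed

lemma card_2_field_CHAR:
  assumes "CARD('a::{finite, field}) = 2"
  shows "CHAR('a) = 2"
proof (rule CHAR_eq_posI)
  have "(1::'a) + 1 \<noteq> 1" by (metis add.right_neutral add_left_cancel zero_neq_one)
  then show "of_nat 2 = (0::'a)"
    using card_2_field_nonzero_eq_1[OF assms, of "1 + 1"] by (metis of_nat_numeral one_add_one)
next
  fix x :: nat assume "x > 0" "x < 2"
  then have "x = 1" by simp
  then show "of_nat x \<noteq> (0::'a)" by simp
qed simp

text \<open>Squaring is additive here: it squares each coefficient and doubles its exponent, so no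
  terms merge.\<close>

lemma poly_weight_square:
  fixes p :: "'a::field poly"
  assumes "CHAR('a) = 2"
  shows "poly_weight (p\<^sup>2) = poly_weight p"
proof (induction p)
  case (pCons a p)
  have "(pCons a p)\<^sup>2 = ([:a:] + pCons 0 p)\<^sup>2" by simp
  also have "\<dots> = [:a:]\<^sup>2 + (pCons 0 p)\<^sup>2"
    using assms by (intro freshmans_dream) (auto simp: semiring_char_poly)
  also have "\<dots> = pCons (a\<^sup>2) (pCons 0 (p\<^sup>2))"
    by (simp add: power2_eq_square)
  finally show ?case using pCons by (simp add: poly_weight_pCons)
qed simp

lemma poly_weight_power_of_2:
  fixes p :: "'a::field poly"
  assumes "CHAR('a) = 2"
  shows "poly_weight (p ^ (2 ^ k)) = poly_weight p"
proof (induction k)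
  case (Suc k)
  have "p ^ (2 ^ Suc k) = (p ^ (2 ^ k))\<^sup>2" by (simp add: mult.commute flip: power_mult)
  then show ?case using Suc poly_weight_square[OF assms] by simp
qed simp

lemma x_pow_minus_one_double:
  assumes "CHAR('a::field) = 2"
  shows "x_pow_minus_one (2 * n) = (x_pow_minus_one n :: 'a poly)\<^sup>2"
proof -
  have C: "CHAR('a poly) = 2" using assms by (simp add: semiring_char_poly)
  have "(x_pow_minus_one n :: 'a poly)\<^sup>2 = (monom 1 n + 1)\<^sup>2"
    using C by (simp add: minus_CHAR_2)
  also have "\<dots> = (monom 1 n)\<^sup>2 + 1\<^sup>2" using C by (intro freshmans_dream) auto
  also have "\<dots> = x_pow_minus_one (2 * n)"
    using C by (simp add: minus_CHAR_2 monom_power mult.commute)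
  finally show ?thesis ..
qed

text \<open>Over two elements, \<open>p ^ (2 ^ m)\<close> is \<open>p\<close> with
  \<open>x^(2^m)\<close> substituted for \<open>x\<close>, and that power is congruent to
  \<open>x\<close>. Squaring is thus invertible modulo \<open>x^n - 1\<close>, which later supplies
  square roots of words.\<close>

lemma power_mod_x_pow_minus_one:
  fixes p :: "'a::{finite, field} poly"
  assumes card: "CARD('a) = 2" and n: "n = 2 ^ m - 1"
  shows "x_pow_minus_one n dvd p ^ (2 ^ m) - p"
proof (induction p)
  case 0
  then show ?case by (simp add: power_0_left)
next
  case (pCons a p)
  let ?x = "monom 1 1 :: 'a poly"
  have C: "CHAR('a) = 2" using card_2_field_CHAR[OF card] .
  have "a = 0 \<or> a = 1" using card_2_field_nonzero_eq_1[OF card] by blast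
  then have a: "[:a:] ^ (2 ^ m) = [:a:]" by (auto simp: power_0_left simp flip: one_pCons)
  have "pCons a p = [:a:] + ?x * p"
    by (simp add: monom_altdef)
  then have "pCons a p ^ (2 ^ m) = ([:a:] + ?x * p) ^ (2 ^ m)" by simp
  also have "\<dots> = [:a:] ^ (2 ^ m) + (?x * p) ^ (2 ^ m)"
    by (rule freshmans_dream'[of _ m]) (auto simp: C semiring_char_poly)
  also have "\<dots> = [:a:] + ?x ^ (2 ^ m) * p ^ (2 ^ m)" by (simp add: a power_mult_distrib)
  finally have "pCons a p ^ (2 ^ m) - pCons a p =
      ?x ^ (2 ^ m) * (p ^ (2 ^ m) - p) + (?x ^ (2 ^ m) - ?x) * p"
    using \<open>pCons a p = [:a:] + ?x * p\<close> by (simp add: algebra_simps)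
  moreover have "?x ^ (2 ^ m) - ?x = x_pow_minus_one n * ?x"
  proof -
    have "n + 1 = 2 ^ m" using n by simp
    then have "?x ^ (2 ^ m) = ?x ^ (n + 1)" by simp
    then show ?thesis by (simp add: monom_power mult_monom algebra_simps)
  qed
  ultimately show ?case using pCons by simp
qed

text \<open>Separability: \<open>f = x^n - 1\<close> satisfies \<open>x * f' = n * f + n\<close>, so
  a common factor of \<open>g\<close> and \<open>h\<close> divides the nonzero constant
  \<open>n\<close>.\<close>

lemma coprime_factors_x_pow_minus_one:
  fixes g h :: "'a::field_gcd poly"
  assumes gh: "g * h = x_pow_minus_one n" and n: "of_nat n \<noteq> (0 :: 'a)"
  shows "coprime g h"
proof (rule coprimeI)
  fix c assume c: "c dvd g" "c dvd h"
  have n0: "n > 0" using n by (cases n) auto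
  have "c dvd pderiv (g * h)" using c by (simp add: pderiv_mult)
  then have "c dvd monom 1 1 * pderiv (g * h)" by simp
  moreover have "monom 1 1 * pderiv (g * h) = [:of_nat n:] * (g * h) + [:of_nat n:]"
    unfolding gh using n0 by (simp add: pderiv_diff pderiv_monom mult_monom smult_monom algebra_simps)
  moreover have "c dvd [:of_nat n:] * (g * h)" using c(1) by (intro dvd_mult dvd_mult2)
  ultimately have "c dvd [:of_nat n:]" by (metis dvd_add_right_iff)
  moreover have "[:of_nat n:] dvd (1 :: 'a poly)" using n by (simp add: is_unit_const_poly_iff)
  ultimately show "is_unit c" by (rule dvd_trans)
qed

subsection \<open>Minimum distance of the doubled code\<close>

text \<open>The formula is that of the (u|u+v) construction. Through \<open>g dvd gd\<close> the
  code of \<open>gd\<close> lies in that of \<open>g\<close>; this makes squares of words of the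
  former divisible by \<open>g * gd\<close>, and in the lower bound it passes from \<open>gd\<close>
  to \<open>g\<close>.\<close>

lemma min_weight_repeated_root_code:
  fixes g h gd :: "'a::{finite, field_gcd} poly"
  assumes card: "CARD('a) = 2" and m: "m > 0" and n: "n = 2 ^ m - 1"
    and gh: "g * h = x_pow_minus_one n" and gd: "gd dvd x_pow_minus_one n" and "g dvd gd"
    and small: "degree g < n" "degree gd < n"
  defines "W \<equiv> \<lambda>N g. {p :: 'a poly. p \<noteq> 0 \<and> degree p < N \<and> g dvd p}"
  shows "Inf (poly_weight ` W (2 * n) (g * gd)) =
    min (2 * Inf (poly_weight ` W n g)) (Inf (poly_weight ` W n gd))"
proof -
  have C: "CHAR('a) = 2" by (rule card_2_field_CHAR[OF card])
  then have Cp: "CHAR('a poly) = 2" by (simp add: semiring_char_poly)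
  have n0: "n > 0" using small by simp
  let ?X = "x_pow_minus_one n :: 'a poly"
  have X0: "?X \<noteq> 0" by (rule x_pow_minus_one_nonzero[OF n0])
  have nz: "g \<noteq> 0" "gd \<noteq> 0" using gh gd X0 by auto
  have mono: "X = monom 1 n + 1" if "X = ?X" for X using Cp that by (simp add: minus_CHAR_2)
  \<comment> \<open>Odd length keeps \<open>n\<close> nonzero in characteristic two, which makes
    \<open>g\<close> and \<open>h\<close> coprime.\<close>
  have "odd n" using n m by simp
  then have "of_nat n \<noteq> (0 :: 'a)"
    using C by (simp add: of_nat_eq_0_iff_char_dvd)
  then have cop: "coprime g h" using gh by (intro coprime_factors_x_pow_minus_one)
  have "g \<in> W n g" "gd \<in> W n gd" using nz small by (auto simp: W_def)
  then have ne: "poly_weight ` W n g \<noteq> {}" "poly_weight ` W n gd \<noteq> {}" by auto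
  have le: "Inf (poly_weight ` W N p) \<le> poly_weight q" if "q \<in> W N p" for N p q
    using that by (intro wellorder_Inf_le1) auto

  have up1: "Inf (poly_weight ` W (2 * n) (g * gd)) \<le> 2 * Inf (poly_weight ` W n g)"
  proof -
    obtain b where b: "b \<in> W n g" "Inf (poly_weight ` W n g) = poly_weight b"
      using Inf_nat_def1[OF ne(1)] by auto
    have "gd * g dvd ?X * b" using gd b by (intro mult_dvd_mono) (auto simp: W_def)
    moreover have "degree (?X * b) < 2 * n" using b X0 by (simp add: W_def degree_mult_eq)
    ultimately have "?X * b \<in> W (2 * n) (g * gd)" using b X0 by (simp add: W_def mult.commute)
    moreover have "poly_weight (?X * b) = 2 * poly_weight b"
    proof -
      have "?X * b = b + monom 1 n * b" using mono[OF refl] by (simp add: algebra_simps)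
      then show ?thesis
        using poly_weight_add_shift[of n b b] b by (simp add: W_def coeff_eq_0)
    qed
    ultimately show ?thesis using le b by metis
  qed

  have up2: "Inf (poly_weight ` W (2 * n) (g * gd)) \<le> Inf (poly_weight ` W n gd)"
  proof -
    obtain v where v: "v \<in> W n gd" "Inf (poly_weight ` W n gd) = poly_weight v"
      using Inf_nat_def1[OF ne(2)] by auto
    text \<open>A square root of \<open>v\<close> modulo \<open>x\<^sup>n - 1\<close> of the same weight.\<close>
    define w where "w = v ^ (2 ^ (m - 1)) mod ?X"
    have w2: "w\<^sup>2 mod ?X = v"
    proof -
      have "w\<^sup>2 mod ?X = (v ^ (2 ^ (m - 1)))\<^sup>2 mod ?X" by (simp add: w_def power_mod)
      also have "(v ^ (2 ^ (m - 1)))\<^sup>2 = v ^ (2 ^ m)"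
        using m by (cases m) (auto simp: mult.commute simp flip: power_mult)
      also have "\<dots> mod ?X = v mod ?X"
        using power_mod_x_pow_minus_one[OF card n, of v]
        by (simp add: dvd_eq_mod_eq_0 poly_mod_diff_left)
      also have "\<dots> = v" using v by (simp add: W_def mod_poly_less)
      finally show ?thesis .
    qed
    have w0: "w \<noteq> 0" using w2 v by (auto simp: W_def)
    have "gd dvd v" using v by (simp add: W_def)
    moreover have "v dvd v ^ (2 ^ (m - 1))" by (rule dvd_power) simp
    ultimately have "gd dvd v ^ (2 ^ (m - 1))" by (rule dvd_trans)
    then have "gd dvd w" using gd by (simp add: w_def dvd_mod_iff)
    then have "g * gd dvd w\<^sup>2" using \<open>g dvd gd\<close>
      unfolding power2_eq_square by (intro mult_dvd_mono) (auto elim: dvd_trans)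
    moreover have "degree w < n"
      using w0 degree_mod_less'[OF X0, of "v ^ (2 ^ (m - 1))"] unfolding w_def by simp
    ultimately have "w\<^sup>2 \<in> W (2 * n) (g * gd)"
      using w0 by (simp add: W_def degree_power_eq)
    then have "Inf (poly_weight ` W (2 * n) (g * gd)) \<le> poly_weight (w\<^sup>2)" by (rule le)
    also have "\<dots> = poly_weight w" by (rule poly_weight_square[OF C])
    also have "\<dots> \<le> poly_weight (v ^ (2 ^ (m - 1)))"
      unfolding w_def by (rule poly_weight_mod_x_pow_minus_one[OF n0])
    also have "\<dots> = poly_weight v" by (rule poly_weight_power_of_2[OF C])
    finally show ?thesis using v by simp
  qed

  have low: "min (2 * Inf (poly_weight ` W n g)) (Inf (poly_weight ` W n gd)) \<le> poly_weight c"
    if c: "c \<in> W (2 * n) (g * gd)" for c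
  proof -
    define A B where "A = poly_cutoff n c" and "B = poly_shift n c"
    have cAB: "c = A + monom 1 n * B" unfolding A_def B_def by (rule poly_cutoff_shift)
    have cX: "c = (A + B) + ?X * B" by (subst cAB) (simp add: algebra_simps)
    have deg: "degree A < n" "degree B < n"
      using c n0 by (auto simp: A_def B_def W_def intro!: degree_poly_cutoff_less degree_poly_shift_less)
    have wt: "poly_weight c = poly_weight A + poly_weight B"
      unfolding A_def B_def by (rule poly_weight_cutoff_shift)
    \<comment> \<open>\<open>A + B\<close> is \<open>c\<close> folded modulo \<open>x^n - 1\<close>,
      and \<open>gd\<close> divides both \<open>c\<close> and the modulus.\<close>
    have dvd: "gd dvd A + B"
    proof -
      have "gd dvd c" using c by (auto simp: W_def intro: dvd_mult_right)
      moreover have "gd dvd ?X * B" using gd by simp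
      ultimately show ?thesis using cX by (metis dvd_add_left_iff)
    qed
    show ?thesis
    proof (cases "A + B = 0")
      case False
      then have "A + B \<in> W n gd" using dvd deg by (auto simp: W_def intro: degree_add_less)
      then have "Inf (poly_weight ` W n gd) \<le> poly_weight (A + B)" by (rule le)
      then show ?thesis using poly_weight_add_le[of A B] wt by linarith
    next
      case True
      then have AB: "A = B" using Cp by (metis eq_neg_iff_add_eq_0 uminus_CHAR_2)
      \<comment> \<open>Here \<open>c = (x^n - 1) * B\<close>; cancelling one \<open>g\<close> and
        using coprimality to \<open>h\<close> leaves \<open>g dvd B\<close>.\<close>
      have "c = g * (h * B)" using cX True gh by (simp flip: mult.assoc)
      moreover have "g * gd dvd c" using c by (simp add: W_def)
      ultimately have "g * gd dvd g * (h * B)" by metis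
      then have "gd dvd h * B" using nz by simp
      then have "g dvd h * B" using \<open>g dvd gd\<close> by (rule dvd_trans[rotated])
      then have "g dvd B" using cop by (simp add: coprime_dvd_mult_right_iff)
      moreover have "B \<noteq> 0" using c cX True by (auto simp: W_def)
      ultimately have "B \<in> W n g" using deg by (simp add: W_def)
      then have "Inf (poly_weight ` W n g) \<le> poly_weight B" by (rule le)
      then show ?thesis using wt AB by simp
    qed
  qed
  have "g * gd \<in> W (2 * n) (g * gd)" using nz small by (simp add: W_def degree_mult_eq)
  then have "poly_weight ` W (2 * n) (g * gd) \<noteq> {}" by auto
  then have "Inf (poly_weight ` W (2 * n) (g * gd)) \<in> poly_weight ` W (2 * n) (g * gd)"
    by (rule Inf_nat_def1)
  then show ?thesis using low up1 up2 by (intro antisym) auto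
qed

subsection \<open>Minimal polynomials\<close>

text \<open>\<open>r\<close> witnesses that \<open>x\<close> is algebraic, so that the definite
  description has a referent. It is unique because two monic candidates have equal degree, and their
  difference would have smaller degree.\<close>

lemma min_poly_correct:
  fixes \<iota> :: "'a::field \<Rightarrow> 'b::field"
  assumes "field_hom \<iota>" and r: "r \<noteq> 0" "poly (map_poly \<iota> r) x = 0"
  shows "lead_coeff (min_poly \<iota> x) = 1 \<and> poly (map_poly \<iota> (min_poly \<iota> x)) x = 0 \<and>
     (\<forall>r. r \<noteq> 0 \<and> poly (map_poly \<iota> r) x = 0 \<longrightarrow> degree (min_poly \<iota> x) \<le> degree r)"
  unfolding min_poly_def
proof (rule theI')
  interpret h: field_hom \<iota> by fact
  interpret M: map_poly_inj_idom_hom \<iota> ..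
  obtain p0 where p0: "p0 \<noteq> 0 \<and> poly (map_poly \<iota> p0) x = 0"
      "\<And>r. r \<noteq> 0 \<and> poly (map_poly \<iota> r) x = 0 \<Longrightarrow> degree p0 \<le> degree r"
    using ex_has_least_nat[of "\<lambda>r. r \<noteq> 0 \<and> poly (map_poly \<iota> r) x = 0" r degree] r by blast
  define p where "p = Polynomial.smult (inverse (lead_coeff p0)) p0"
  show "\<exists>!p. lead_coeff p = 1 \<and> poly (map_poly \<iota> p) x = 0 \<and>
     (\<forall>r. r \<noteq> 0 \<and> poly (map_poly \<iota> r) x = 0 \<longrightarrow> degree p \<le> degree r)"
  proof (rule ex1I[of _ p])
    show "lead_coeff p = 1 \<and> poly (map_poly \<iota> p) x = 0 \<and>
     (\<forall>r. r \<noteq> 0 \<and> poly (map_poly \<iota> r) x = 0 \<longrightarrow> degree p \<le> degree r)"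
      using p0 by (auto simp: p_def h.map_poly_hom_smult)
  next
    fix q assume q: "lead_coeff q = 1 \<and> poly (map_poly \<iota> q) x = 0 \<and>
     (\<forall>r. r \<noteq> 0 \<and> poly (map_poly \<iota> r) x = 0 \<longrightarrow> degree q \<le> degree r)"
    then have "q \<noteq> 0" by auto
    have p: "lead_coeff p = 1" "poly (map_poly \<iota> p) x = 0" "degree p = degree p0" "p \<noteq> 0"
      using p0 by (auto simp: p_def h.map_poly_hom_smult)
    then have deq: "degree q = degree p" using q p0 \<open>q \<noteq> 0\<close> by (metis le_antisym)
    show "q = p"
    proof (rule ccontr)
      assume "q \<noteq> p"
      then have ne: "q - p \<noteq> 0" by simp
      moreover have "poly (map_poly \<iota> (q - p)) x = 0" using p q by (simp add: M.hom_minus)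
      ultimately have "degree q \<le> degree (q - p)" using q by blast
      moreover have "degree (q - p) \<le> degree q" using deq by (metis degree_diff_le order_refl)
      ultimately have "coeff (q - p) (degree q) \<noteq> 0" using ne by (metis le_antisym leading_coeff_0_iff)
      then show False using p q deq by simp
    qed
  qed
qed

lemma min_poly_dvd:
  fixes \<iota> :: "'a::field \<Rightarrow> 'b::field"
  assumes hom: "field_hom \<iota>" and r: "poly (map_poly \<iota> r) x = 0"
  shows "min_poly \<iota> x dvd r"
proof (cases "r = 0")
  case False
  interpret h: field_hom \<iota> by fact
  interpret M: map_poly_inj_idom_hom \<iota> ..
  let ?p = "min_poly \<iota> x"
  note p = min_poly_correct[OF hom False r]
  then have "?p \<noteq> 0" by auto
  have "r = ?p * (r div ?p) + r mod ?p" by simp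
  then have "map_poly \<iota> r = map_poly \<iota> ?p * map_poly \<iota> (r div ?p) + map_poly \<iota> (r mod ?p)"
    by (metis M.hom_add M.hom_mult)
  then have "poly (map_poly \<iota> (r mod ?p)) x = 0" using p r by simp
  then have "r mod ?p = 0"
    using p degree_mod_less'[OF \<open>?p \<noteq> 0\<close>, of r] by (metis not_le)
  then show ?thesis by (rule mod_0_imp_dvd)
qed simp

text \<open>The product over the Frobenius orbit is fixed by squaring its coefficients, so they lie in
  the prime field.\<close>

lemma conjugates_poly_descends:
  fixes \<iota> :: "'a::{finite, field} \<Rightarrow> 'b::field"
  assumes hom: "field_hom \<iota>" and card: "CARD('a) = 2" and b: "b ^ (2 ^ m) = b"
  shows "\<exists>p. map_poly \<iota> p = (\<Prod>s<m. [:- (b ^ (2 ^ s)), 1:])"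
proof -
  interpret field_hom \<iota> by fact
  have "(2 :: 'b) = \<iota> (of_nat 2)" by (simp add: hom_numeral)
  also have "of_nat 2 = (0 :: 'a)" using card_2_field_CHAR[OF card] by (metis of_nat_CHAR)
  finally have two: "(2 :: 'b) = 0" by simp
  have "CHAR('b) = 2"
  proof (rule CHAR_eq_posI)
    fix x :: nat assume "x > 0" "x < 2"
    then have "x = 1" by simp
    then show "of_nat x \<noteq> (0::'b)" by simp
  qed (use two in auto)
  then have C: "prime CHAR('b)" "2 = CHAR('b)" by auto
  interpret F: comm_ring_hom "\<lambda>x::'b. x\<^sup>2"
    by unfold_locales (use freshmans_dream[OF C] in \<open>auto simp: power_mult_distrib\<close>)
  interpret F': map_poly_comm_ring_hom "\<lambda>x::'b. x\<^sup>2" ..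
  define f where "f = (\<lambda>s::nat. [:- (b ^ (2 ^ s)), 1:])"
  define P where "P = (\<Prod>s<m. f s)"
  have "map_poly (\<lambda>x. x\<^sup>2) (f s) = f (Suc s)" for s
  proof -
    have "(b ^ 2 ^ s)\<^sup>2 = b ^ 2 ^ Suc s"
      by (simp add: mult.commute flip: power_mult)
    then have "(- (b ^ 2 ^ s))\<^sup>2 = - (b ^ 2 ^ Suc s)"
      using uminus_CHAR_2[OF C(2)[symmetric], of "b ^ 2 ^ Suc s"] by (metis power2_minus)
    then show ?thesis by (simp add: f_def map_poly_pCons)
  qed
  then have "map_poly (\<lambda>x. x\<^sup>2) P = (\<Prod>s<m. f (Suc s))"
    unfolding P_def by (simp add: F'.hom_prod)
  \<comment> \<open>Squaring shifts the factors by one place, and the last wraps around to the first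
    since \<open>b ^ (2 ^ m) = b\<close>.\<close>
  moreover have "f 0 * (\<Prod>s<m. f (Suc s)) = (\<Prod>s<m. f s) * f m"
    by (metis prod.lessThan_Suc prod.lessThan_Suc_shift)
  moreover have "f m = f 0" "f 0 \<noteq> 0" using b by (auto simp: f_def)
  ultimately have "map_poly (\<lambda>x. x\<^sup>2) P = P" unfolding P_def by (simp add: mult.commute)
  then have "(coeff P i)\<^sup>2 = coeff P i" for i by (metis F.coeff_map_poly_hom)
  then have "coeff P i = 0 \<or> coeff P i = 1" for i
    by (metis mult_cancel_right1 power2_eq_square)
  then have "map_poly \<iota> (map_poly (\<lambda>x. if x = 0 then 0 else 1) P) = P"
    by (intro poly_eqI) (auto simp: coeff_map_poly)
  then show ?thesis unfolding P_def f_def by blast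
qed

lemma poly_root_of_dvd:
  assumes "field_hom \<iota>" "p dvd q" "poly (map_poly \<iota> p) y = 0"
  shows "poly (map_poly \<iota> q) y = 0"
proof -
  interpret h: field_hom \<iota> by fact
  interpret M: map_poly_inj_idom_hom \<iota> ..
  obtain r where "q = p * r" using assms(2) by (rule dvdE)
  then show ?thesis using assms(3) by (simp add: M.hom_mult)
qed

text \<open>Bounds the zeros of a BCH generator from above: it divides a product of conjugate
  polynomials with explicit zeros. Repeated conjugates, when the orbit is shorter than
  \<open>m\<close>, do no harm to divisibility.\<close>

lemma Lcm_min_poly_root:
  fixes \<iota> :: "'a::{finite, field_gcd} \<Rightarrow> 'b::field"
  assumes hom: "field_hom \<iota>" and card: "CARD('a) = 2"
    and B: "finite B" "\<And>b. b \<in> B \<Longrightarrow> b ^ (2 ^ m) = b" "m > 0"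
    and root: "poly (map_poly \<iota> (Lcm (min_poly \<iota> ` B))) y = 0"
  shows "\<exists>b\<in>B. \<exists>s<m. y = b ^ (2 ^ s)"
proof -
  interpret h: field_hom \<iota> by fact
  interpret M: map_poly_inj_idom_hom \<iota> ..
  obtain p where p: "\<And>b. b \<in> B \<Longrightarrow> map_poly \<iota> (p b) = (\<Prod>s<m. [:- (b ^ (2 ^ s)), 1:])"
    using conjugates_poly_descends[OF hom card B(2)] by metis
  have "min_poly \<iota> b dvd prod p B" if b: "b \<in> B" for b
  proof -
    have "poly (map_poly \<iota> (p b)) b = 0"
      using p[OF b] B(3) by (auto simp: poly_prod intro: bexI[of _ 0])
    then have "min_poly \<iota> b dvd p b" by (rule min_poly_dvd[OF hom])
    then show ?thesis using b B(1) by (meson dvd_prodI dvd_trans)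
  qed
  then have "Lcm (min_poly \<iota> ` B) dvd prod p B" by (intro Lcm_least) auto
  then have "poly (map_poly \<iota> (prod p B)) y = 0"
    using root by (rule poly_root_of_dvd[OF hom])
  then obtain b where "b \<in> B" "poly (map_poly \<iota> (p b)) y = 0"
    using B(1) by (auto simp: M.hom_prod poly_prod)
  then show ?thesis using p by (auto simp: poly_prod)
qed

subsection \<open>Cyclotomic arithmetic\<close>

lemma primitive_root_power_eq_1_iff:
  assumes "primitive_root_of_unity n \<beta>"
  shows "\<beta> ^ k = 1 \<longleftrightarrow> n dvd k"
proof
  have \<beta>: "n > 0" "\<beta> ^ n = 1" "\<And>k. 0 < k \<Longrightarrow> k < n \<Longrightarrow> \<beta> ^ k \<noteq> 1"
    using assms by (auto simp: primitive_root_of_unity_def)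
  show "n dvd k" if "\<beta> ^ k = 1"
  proof -
    have "\<beta> ^ k = \<beta> ^ (n * (k div n) + k mod n)" by simp
    also have "\<dots> = \<beta> ^ (k mod n)" by (simp only: power_add power_mult \<beta>(2)) simp
    finally have "k mod n = 0" using that \<beta>(1) \<beta>(3)[of "k mod n"] by force
    then show ?thesis by auto
  qed
  show "\<beta> ^ k = 1" if "n dvd k"
    using that \<beta>(2) by (elim dvdE) (simp add: power_mult)
qed

lemma primitive_root_nonzero: "primitive_root_of_unity n (\<beta> :: 'b::field) \<Longrightarrow> \<beta> \<noteq> 0"
  by (auto simp: primitive_root_of_unity_def power_0_left)

lemma primitive_root_inj_on:
  assumes "primitive_root_of_unity n (\<beta> :: 'b::field)"
  shows "inj_on (\<lambda>i. \<beta> ^ i) {..<n}"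
proof -
  have "i = j" if "i \<le> j" "j < n" "\<beta> ^ i = \<beta> ^ j" for i j
  proof -
    have "\<beta> ^ i * \<beta> ^ (j - i) = \<beta> ^ (i + (j - i))" by (rule power_add[symmetric])
    also have "\<dots> = \<beta> ^ i * 1" using that by simp
    finally have "\<beta> ^ (j - i) = 1" using primitive_root_nonzero[OF assms] by simp
    then have "n dvd j - i" using primitive_root_power_eq_1_iff[OF assms] by simp
    then show ?thesis using that by (cases "j - i = 0") (auto dest: dvd_imp_le)
  qed
  then show ?thesis by (intro linorder_inj_onI') (metis lessThan_iff less_imp_le nat_neq_iff)
qed

text \<open>For \<open>s \<ge> k\<close>, multiplying by \<open>2\<^bsup>m - s\<^esup>\<close> modulo \<open>n\<close> moves the power of two from \<open>i\<close> to \<open>j\<close>.\<close>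

lemma not_dvd_shifted_sum:
  fixes i j k m n s :: nat
  assumes m: "m + 1 = 2 * k" and n: "n = 2 ^ m - 1" and k: "k \<ge> 3"
    and i: "1 \<le> i" "i \<le> 2 ^ k - 4" and j: "j \<le> 2 ^ k - 2" and s: "s < m"
  shows "\<not> n dvd i * 2 ^ s + j"
proof
  assume dvd: "n dvd i * 2 ^ s + j"
  \<comment> \<open>With this \<open>a\<close>, \<open>2 ^ k = 2 * a\<close> and
    \<open>n + 1 = 2 * a^2\<close>, so the size estimates become polynomial inequalities in
    \<open>a\<close>.\<close>
  define a :: nat where "a = 2 ^ (k - 1)"
  have a4: "a \<ge> 4" using k power_increasing[of 2 "k - 1" "2::nat"] by (simp add: a_def)
  have "2 ^ k = 2 * a" using k by (cases k) (auto simp: a_def)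
  then have i: "1 \<le> i" "i + 4 \<le> 2 * a" and j: "j + 2 \<le> 2 * a" using i j a4 by auto
  have "m = k + (k - 1)" using m k by simp
  then have "2 ^ m = 2 * (a * a)"
    by (simp only: power_add \<open>2 ^ k = 2 * a\<close>) (simp add: a_def)
  then have n_a: "n + 1 = 2 * (a * a)" using n a4 by simp
  have ia: "i * a + 4 * a \<le> 2 * (a * a)" using mult_le_mono1[OF i(2), of a] by (simp add: algebra_simps)
  have ja: "j * a + 2 * a \<le> 2 * (a * a)" using mult_le_mono1[OF j, of a] by (simp add: algebra_simps)
  have small: "2 ^ r \<le> a" if "r \<le> k - 1" for r
    using that unfolding a_def by (intro power_increasing) auto
  show False
  proof (cases "s \<le> k - 1")
    case True
    have "i * 2 ^ s \<le> i * a" using small[OF True] by simp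
    then have "i * 2 ^ s + j < n" using ia j n_a a4 by linarith
    moreover have "i * 2 ^ s + j > 0" using i by simp
    ultimately show False using dvd by (auto dest: dvd_imp_le)
  next
    case False
    define r where "r = m - s"
    have r: "r \<le> k - 1" "s + r = m" using False s m by (auto simp: r_def)
    have "2 ^ m = n + 1" using n by simp
    have "(i * 2 ^ s + j) * 2 ^ r = i * 2 ^ (s + r) + j * 2 ^ r"
      by (simp add: power_add algebra_simps)
    also have "\<dots> = i * n + (i + j * 2 ^ r)"
      by (simp only: r(2) \<open>2 ^ m = n + 1\<close>) (simp add: algebra_simps)
    finally have "n dvd i * n + (i + j * 2 ^ r)" using dvd by (metis dvd_mult2)
    then have "n dvd i + j * 2 ^ r" by (metis dvd_add_right_iff dvd_triv_right)
    moreover have "j * 2 ^ r \<le> j * a" using small[OF r(1)] by simp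
    then have "i + j * 2 ^ r < n" using ja i n_a a4 by linarith
    moreover have "i + j * 2 ^ r > 0" using i by simp
    ultimately show False by (auto dest: dvd_imp_le)
  qed
qed

subsection \<open>The self-dual code\<close>

lemma poly_weight_map_poly:
  assumes "field_hom \<iota>"
  shows "poly_weight (map_poly \<iota> p) = poly_weight p"
proof -
  interpret h: field_hom \<iota> by fact
  show ?thesis by (simp add: poly_weight_def)
qed

lemma bch_bound_code:
  fixes \<iota> :: "'a::field \<Rightarrow> 'b::field"
  assumes hom: "field_hom \<iota>" and inj: "inj_on (\<lambda>i. \<gamma> ^ i) {..<n}" and \<zeta>: "\<zeta> \<noteq> 0"
    and zeros: "\<And>l. l < t \<Longrightarrow> poly (map_poly \<iota> g) (\<zeta> * \<gamma> ^ l) = 0"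
    and ne: "g \<noteq> 0" "degree g < n"
  shows "t < Inf (poly_weight ` {p. p \<noteq> 0 \<and> degree p < n \<and> g dvd p})" (is "_ < Inf (_ ` ?W)")
proof -
  have "t < poly_weight p" if p: "p \<in> ?W" for p
  proof -
    interpret h: field_hom \<iota> by fact
    have "t < poly_weight (map_poly \<iota> p)"
    proof (rule bch_bound)
      show "map_poly \<iota> p \<noteq> 0" using p by (metis (mono_tags) mem_Collect_eq h.degree_map_poly_hom
            h.hom_lead_coeff h.hom_0_iff leading_coeff_0_iff)
      show "inj_on (\<lambda>i. \<gamma> ^ i) {..degree (map_poly \<iota> p)}"
        using p by (intro inj_on_subset[OF inj]) auto
      show "poly (map_poly \<iota> p) (\<zeta> * \<gamma> ^ l) = 0" if "l < t" for l
        using p zeros[OF that] by (auto intro: poly_root_of_dvd[OF hom])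
    qed (rule \<zeta>)
    then show ?thesis by (simp add: poly_weight_map_poly[OF hom])
  qed
  \<comment> \<open>Nonemptiness makes the infimum an attained minimum; over the empty set it would
    be 0.\<close>
  moreover have "g \<in> ?W" using ne by simp
  then have "Inf (poly_weight ` ?W) \<in> poly_weight ` ?W" by (intro Inf_nat_def1) auto
  ultimately show ?thesis by auto
qed

theorem theorem6:
  fixes \<iota> :: "'a::{finite, field_gcd} \<Rightarrow> 'b::{finite, field}"
    and \<beta> :: 'b
    and m n \<delta> d :: nat
    and g h gd :: "'a poly"
    and C C' :: "'a vec set"
  assumes "CARD('a) = 2" and "CARD('b) = 2 ^ m" and "field_hom \<iota>"
    and "odd m"
    and "n = 2 ^ m - 1"
    and "primitive_root_of_unity n \<beta>"
    and "\<delta> = 2 ^ ((m + 1) div 2) - 3" and "\<delta> \<ge> 2"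
    and "C = bch_code \<iota> n \<delta> 1 \<beta>"
    and "g = generator_poly n C"
    and "h = x_pow_minus_one n div g"
    and "gd = Polynomial.smult (inverse (poly h 0)) (reflect_poly h)"
    and "C' = cyclic_code_of (2 * n) (g * gd)"
    and "d = min (2 * min_dist C) (min_dist (euclidean_dual n C))"
  shows "is_generator_poly n (euclidean_dual n C) gd
    \<and> is_generator_poly (2 * n) C' (g * gd)
    \<and> cyclic_code (2 * n) C'
    \<and> euclidean_self_dual (2 * n) C'
    \<and> nkd_code (2 * n) n d C'
    \<and> d \<ge> 2 ^ ((m + 1) div 2)
    \<and> (m = 5 \<longrightarrow> d \<ge> 2 ^ ((m + 1) div 2) + 2 \<and> 2 ^ ((m + 1) div 2) + 2 = (10::nat))"
proof -
  note card = assms(1) and hom = assms(3) and n = assms(5) and prim = assms(6)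
  interpret h: field_hom \<iota> by (rule hom)
  interpret M: map_poly_inj_idom_hom \<iota> ..
  let ?X = "x_pow_minus_one n :: 'a poly"
  define k where "k = (m + 1) div 2"
  have mk: "m + 1 = 2 * k" using \<open>odd m\<close> by (simp add: k_def)
  have \<delta>k: "\<delta> = 2 ^ k - 3" using assms(7) by (simp add: k_def)
  have k3: "k \<ge> 3"
  proof (rule ccontr)
    assume "\<not> k \<ge> 3"
    then have "(2::nat) ^ k \<le> 2 ^ 2" by (intro power_increasing) auto
    then show False using \<open>\<delta> \<ge> 2\<close> \<delta>k by simp
  qed
  have m0: "m > 0" using mk k3 by simp
  have n0: "n > 0" using prim by (simp add: primitive_root_of_unity_def)
  have pow_k: "(2::nat) ^ k \<ge> 8" using k3 power_increasing[of 3 k "2::nat"] by simp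
  have ch: "CHAR('a) = 2" by (rule card_2_field_CHAR[OF card])
  then have chp: "CHAR('a poly) = 2" by (simp add: semiring_char_poly)
  have monic: "lead_coeff p = 1" if "p \<noteq> 0" for p :: "'a poly"
    using that by (intro card_2_field_nonzero_eq_1[OF card]) simp
  have \<beta>0: "\<beta> \<noteq> 0" by (rule primitive_root_nonzero[OF prim])
  have X0: "?X \<noteq> 0" by (rule x_pow_minus_one_nonzero[OF n0])
  have Xroot: "poly (map_poly \<iota> ?X) y = y ^ n - 1" for y
    by (simp add: M.hom_minus poly_monom)

  \<comment> \<open>The generator, its reciprocal cofactor and their zeros\<close>
  define B where "B = (\<lambda>i. \<beta> ^ i) ` {1..\<delta> - 1}"
  define L where "L = Lcm (min_poly \<iota> ` B)"
  have B: "finite B" "\<And>b. b \<in> B \<Longrightarrow> b ^ n = 1"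
  proof -
    have "(\<beta> ^ i) ^ n = 1" for i
      using prim by (metis mult.commute power_mult power_one primitive_root_of_unity_def)
    then show "\<And>b. b \<in> B \<Longrightarrow> b ^ n = 1" by (auto simp: B_def)
  qed (simp add: B_def)
  have B2: "b ^ (2 ^ m) = b" if "b \<in> B" for b
  proof -
    have "2 ^ m = n + 1" using n by simp
    then show ?thesis using B(2)[OF that] by (simp only: power_add) simp
  qed
  have int_image: "(\<lambda>i. min_poly \<iota> (\<beta> powi i)) ` {1..1 + int \<delta> - 2} = min_poly \<iota> ` B"
  proof -
    have "{1..1 + int \<delta> - 2} = int ` {1..\<delta> - 1}"
      using \<open>\<delta> \<ge> 2\<close> by (simp add: image_int_atLeastAtMost of_nat_diff)
    then show ?thesis by (simp add: B_def image_image)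
  qed
  have L_X: "L dvd ?X"
    unfolding L_def by (rule Lcm_least) (auto intro!: min_poly_dvd[OF hom] simp: Xroot B(2))
  then have "L \<noteq> 0" using X0 by auto
  have "C = poly_code n L"
    using assms(9) cyclic_code_of_eq_poly_code[OF n0 L_X]
    unfolding bch_code_def int_image L_def by simp
  moreover have gL: "g = L"
    using assms(10) generator_poly_poly_code[OF n0 L_X monic[OF \<open>L \<noteq> 0\<close>]] calculation by simp
  ultimately have C: "C = poly_code n g" by simp
  have g_X: "g dvd ?X" and g0: "g \<noteq> 0" using L_X \<open>L \<noteq> 0\<close> gL by auto
  then have gh: "g * h = ?X" using assms(11) by simp
  then have h0: "h \<noteq> 0" using X0 by auto
  \<comment> \<open>Both constant terms are nonzero, hence 1, so the normalizing factor in
    \<open>gd\<close> disappears.\<close>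
  have "poly g 0 * poly h 0 = - 1" using n0 by (simp flip: poly_mult add: gh poly_monom)
  then have "poly g 0 \<noteq> 0" "poly h 0 \<noteq> 0" by auto
  then have "poly h 0 = 1" and c0: "coeff g 0 \<noteq> 0" "coeff h 0 \<noteq> 0"
    using card_2_field_nonzero_eq_1[OF card] by (auto simp: poly_0_coeff_0)
  then have gd: "gd = reflect_poly h" using assms(12) by simp
  have rg: "reflect_poly g * gd = ?X"
  proof -
    have "reflect_poly g * gd = - ?X"
      by (simp only: gd gh reflect_x_pow_minus_one flip: reflect_poly_mult)
    then show ?thesis using chp by (simp only: uminus_CHAR_2)
  qed
  then have gd_X: "gd dvd ?X" by (metis dvd_triv_right)
  have gd0: "gd \<noteq> 0" using rg X0 by auto
  have deg_gd: "degree g + degree gd = n"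
  proof -
    have "degree g + degree h = n" using gh g0 h0 by (metis degree_mult_eq degree_x_pow_minus_one)
    then show ?thesis using c0 by (simp add: gd degree_reflect_poly_eq)
  qed

  text \<open>\<open>\<beta>\<^sup>e\<close> is a zero of the dual unless \<open>-e\<close> lies in the defining set of \<open>C\<close>.\<close>
  have dual_root: "poly (map_poly \<iota> gd) (\<beta> ^ e) = 0"
    if e: "\<And>i s. 1 \<le> i \<Longrightarrow> i \<le> 2 ^ k - 4 \<Longrightarrow> s < m \<Longrightarrow> \<not> n dvd i * 2 ^ s + e" for e
  proof -
    \<comment> \<open>A zero of \<open>gd\<close> at \<open>\<beta> ^ e\<close> is a zero of
      \<open>h\<close> at the inverse \<open>y\<close>. As an \<open>n\<close>-th root of unity,
      \<open>y\<close> is a zero of \<open>g\<close> or of \<open>h\<close>, and the assumption on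
      \<open>e\<close> excludes \<open>g\<close>.\<close>
    define y where "y = inverse (\<beta> ^ e)"
    have "y ^ n = 1"
      using prim by (simp add: y_def primitive_root_of_unity_def power_inverse flip: power_mult)
        (metis inverse_1 mult.commute power_mult power_one)
    then have "poly (map_poly \<iota> g * map_poly \<iota> h) y = 0"
      using Xroot[of y] by (simp flip: gh M.hom_mult)
    then consider "poly (map_poly \<iota> g) y = 0" | "poly (map_poly \<iota> h) y = 0" by auto
    then show ?thesis
    proof cases
      case 1
      then obtain i s where ys: "i \<in> {1..\<delta> - 1}" "s < m" "y = (\<beta> ^ i) ^ (2 ^ s)"
        using Lcm_min_poly_root[OF hom card B(1) B2 m0, of y] unfolding gL L_def B_def by auto
      then have "\<beta> ^ (i * 2 ^ s + e) = y * \<beta> ^ e" by (simp add: ys(3) power_add power_mult)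
      also have "\<dots> = 1" using \<beta>0 by (simp add: y_def)
      finally have "n dvd i * 2 ^ s + e" using primitive_root_power_eq_1_iff[OF prim] by blast
      then show ?thesis using e[of i s] ys \<delta>k by auto
    next
      case 2
      have "map_poly \<iota> gd = reflect_poly (map_poly \<iota> h)"
        by (rule poly_eqI) (simp add: gd coeff_reflect_poly)
      then show ?thesis using 2 \<beta>0 by (simp add: poly_reflect_poly_nz y_def)
    qed
  qed
  \<comment> \<open>The exponents start at 0, which gives a run of \<open>2 ^ k - 1\<close>
    consecutive zeros.\<close>
  have dual_root': "poly (map_poly \<iota> gd) (\<beta> ^ e) = 0" if "e \<le> 2 ^ k - 2" for e
    using that not_dvd_shifted_sum[OF mk n k3] by (intro dual_root) auto
  have g_root: "poly (map_poly \<iota> g) (\<beta> ^ i) = 0" if "i \<in> {1..\<delta> - 1}" for i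
  proof -
    have "\<beta> ^ i \<in> B" using that by (simp add: B_def)
    then have "min_poly \<iota> (\<beta> ^ i) dvd g" unfolding gL L_def by (intro dvd_Lcm) auto
    moreover have "poly (map_poly \<iota> (min_poly \<iota> (\<beta> ^ i))) (\<beta> ^ i) = 0"
      using min_poly_correct[OF hom X0] B(2)[OF \<open>\<beta> ^ i \<in> B\<close>] by (simp add: Xroot)
    ultimately show ?thesis by (rule poly_root_of_dvd[OF hom])
  qed
  \<comment> \<open>The prescribed zeros of \<open>g\<close> have exponents up to
    \<open>\<delta> - 1 = 2 ^ k - 4\<close>, inside the run of zeros of \<open>gd\<close>.\<close>
  have g_gd: "g dvd gd"
    unfolding gL L_def B_def using \<delta>k
    by (intro Lcm_least) (auto intro!: min_poly_dvd[OF hom] dual_root')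
  \<comment> \<open>Since the degrees add up to \<open>n\<close>, it suffices that neither
    polynomial is constant: \<open>\<beta>\<close> is a zero of \<open>g\<close> and 1 is a zero of
    \<open>gd\<close>.\<close>
  have deg: "degree g < n" "degree gd < n"
  proof -
    have "degree g \<noteq> 0"
    proof
      assume "degree g = 0"
      then obtain c where "g = [:c:]" by (rule degree_eq_zeroE)
      moreover have "1 \<in> {1..\<delta> - 1}" using \<open>\<delta> \<ge> 2\<close> by auto
      ultimately show False using g_root[of 1] g0 by (simp add: map_poly_pCons)
    qed
    moreover have "degree gd \<noteq> 0"
    proof
      assume "degree gd = 0"
      then obtain c where "gd = [:c:]" by (rule degree_eq_zeroE)
      then show False using dual_root'[of 0] gd0 by (simp add: map_poly_pCons)
    qed
    ultimately show "degree g < n" "degree gd < n" using deg_gd by auto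
  qed

  \<comment> \<open>Duals and self-duality\<close>
  have dual: "euclidean_dual n C = poly_code n gd"
    unfolding C gd by (rule euclidean_dual_poly_code[OF n0 gh])
  have gen_dual: "is_generator_poly n (euclidean_dual n C) gd"
    using is_generator_poly_iff[OF n0] dual gd_X monic[OF gd0] by blast
  have n2: "2 * n > 0" using n0 by simp
  have X2: "x_pow_minus_one (2 * n) = ?X * ?X"
    using x_pow_minus_one_double[OF ch, of n] by (simp add: power2_eq_square)
  then have ggd_X: "g * gd dvd x_pow_minus_one (2 * n)"
    using g_X gd_X by (simp add: mult_dvd_mono)
  have C': "C' = poly_code (2 * n) (g * gd)"
    using assms(13) cyclic_code_of_eq_poly_code[OF n2 ggd_X] by simp
  have gen': "is_generator_poly (2 * n) C' (g * gd)"
  proof -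
    have "g * gd \<noteq> 0" using g0 gd0 by simp
    then have "lead_coeff (g * gd) = 1" by (rule monic)
    then show ?thesis unfolding is_generator_poly_iff[OF n2] by (intro conjI ggd_X C')
  qed

  have "euclidean_dual (2 * n) C' = C'"
  proof -
    \<comment> \<open>The cofactor of \<open>g * gd\<close> is its own reversal, because
      \<open>gd\<close> is the reversal of \<open>h\<close>.\<close>
    have "(g * gd) * (reflect_poly g * h) = x_pow_minus_one (2 * n)"
    proof -
      have "(g * gd) * (reflect_poly g * h) = (g * h) * (reflect_poly g * gd)" by (simp add: mult_ac)
      then show ?thesis by (simp only: gh rg X2)
    qed
    then have "euclidean_dual (2 * n) C' = poly_code (2 * n) (reflect_poly (reflect_poly g * h))"
      unfolding C' by (rule euclidean_dual_poly_code[OF n2])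
    also have "reflect_poly (reflect_poly g * h) = g * gd"
      using c0 by (simp add: reflect_poly_mult gd)
    finally show ?thesis using C' by simp
  qed
  then have self_dual: "euclidean_self_dual (2 * n) C'" by (simp add: euclidean_self_dual_def)

  \<comment> \<open>Length, dimension and minimum distance\<close>
  have d_eq: "d = min (2 * Inf (poly_weight ` {p. p \<noteq> 0 \<and> degree p < n \<and> g dvd p}))
      (Inf (poly_weight ` {p. p \<noteq> 0 \<and> degree p < n \<and> gd dvd p}))"
    unfolding assms(14) dual unfolding C by (simp only: min_dist_poly_code[OF n0])
  have "min_dist C' = d"
    unfolding d_eq C' min_dist_poly_code[OF n2]
    by (rule min_weight_repeated_root_code[OF card m0 n gh gd_X g_gd deg])
  moreover have "code_dim (2 * n) C' = n"
    unfolding C' using code_dim_poly_code[OF n2, of "g * gd"] g0 gd0 deg_gd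
    by (simp add: degree_mult_eq)
  ultimately have nkd: "nkd_code (2 * n) n d C'"
    using linear_code_poly_code by (auto simp: nkd_code_def C')

  \<comment> \<open>Lower bounds on the distance\<close>
  have dC: "Inf (poly_weight ` {p. p \<noteq> 0 \<and> degree p < n \<and> g dvd p}) \<ge> \<delta>"
  proof -
    have "\<delta> - 1 < Inf (poly_weight ` {p. p \<noteq> 0 \<and> degree p < n \<and> g dvd p})"
      by (rule bch_bound_code[OF hom primitive_root_inj_on[OF prim] \<beta>0])
        (use g_root[of "Suc _"] g0 deg in auto)
    then show ?thesis by simp
  qed
  have dD: "Inf (poly_weight ` {p. p \<noteq> 0 \<and> degree p < n \<and> gd dvd p}) \<ge> 2 ^ k"
  proof -
    have "2 ^ k - 1 < Inf (poly_weight ` {p. p \<noteq> 0 \<and> degree p < n \<and> gd dvd p})"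
      by (rule bch_bound_code[OF hom primitive_root_inj_on[OF prim], of 1])
        (use dual_root' gd0 deg in auto)
    then show ?thesis by simp
  qed
  \<comment> \<open>Doubling \<open>\<delta>\<close> gives \<open>2 * 2 ^ k - 6\<close>, at least
    \<open>2 ^ k\<close> because \<open>2 ^ k \<ge> 8\<close>.\<close>
  have d1: "d \<ge> 2 ^ k" unfolding d_eq using dC dD \<delta>k pow_k by simp

  have d5: "d \<ge> 10" if "m = 5"
  proof -
    have k: "k = 3" "n = 31" using that mk n by auto
    text \<open>The zeros \<open>\<beta>\<^bsup>10 + 26 l\<^esup>\<close>, \<open>l < 9\<close>, form a longer run with respect to the primitive root
      \<open>\<beta>\<^bsup>26\<^esup>\<close>.\<close>
    have "\<forall>i\<in>{1,2,3,4}. \<forall>s\<in>{0,1,2,3,4}. \<forall>l\<in>{0,1,2,3,4,5,6,7,8}.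
        \<not> (31::nat) dvd i * 2 ^ s + (10 + 26 * l)"
      by simp
    moreover have "i \<in> {1,2,3,4}" if "1 \<le> i" "i \<le> 4" for i :: nat using that by auto
    moreover have "s \<in> {0,1,2,3,4}" if "s < 5" for s :: nat using that by auto
    moreover have "l \<in> {0,1,2,3,4,5,6,7,8}" if "l < 9" for l :: nat using that by auto
    ultimately have "\<not> 31 dvd i * 2 ^ s + (10 + 26 * l)"
      if "1 \<le> i" "i \<le> 4" "s < 5" "l < 9" for i s l :: nat
      using that by blast
    \<comment> \<open>Modulo 31 the exponents are 10, 5, 0, 26, 21, 16, 11, 6, 1. Their negatives
      avoid the cyclotomic cosets of 1 and 3, which contain all exponents of zeros of
      \<open>g\<close>.\<close>
    then have "poly (map_poly \<iota> gd) (\<beta> ^ (10 + 26 * l)) = 0" if "l < 9" for l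
      using that k \<open>m = 5\<close> by (intro dual_root) auto
    moreover have "inj_on (\<lambda>i. (\<beta> ^ 26) ^ i) {..<n}"
    proof (rule inj_onI)
      fix i j assume ij: "i \<in> {..<n}" "j \<in> {..<n}" "(\<beta> ^ 26) ^ i = (\<beta> ^ 26) ^ j"
      \<comment> \<open>6 inverts 26 modulo 31, as 6 * 26 = 1 + 5 * 31.\<close>
      have "(\<beta> ^ 26) ^ 6 = \<beta> * (\<beta> ^ 31) ^ 5" by (simp flip: power_mult power_Suc)
      also have "\<beta> ^ 31 = 1" using prim k by (simp add: primitive_root_of_unity_def)
      finally have "\<beta> = (\<beta> ^ 26) ^ 6" by simp
      then have "\<beta> ^ i = ((\<beta> ^ 26) ^ i) ^ 6" "\<beta> ^ j = ((\<beta> ^ 26) ^ j) ^ 6" for i j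
        by (metis mult.commute power_mult)+
      then have "\<beta> ^ i = \<beta> ^ j" using ij(3) by metis
      then show "i = j" using primitive_root_inj_on[OF prim] ij by (auto simp: inj_on_def)
    qed
    ultimately have "9 < Inf (poly_weight ` {p. p \<noteq> 0 \<and> degree p < n \<and> gd dvd p})"
      using \<beta>0 gd0 deg
      by (intro bch_bound_code[OF hom, of "\<beta> ^ 26" n "\<beta> ^ 10"]) (auto simp: power_add power_mult)
    \<comment> \<open>Here \<open>\<delta> = 5\<close>, so twice the distance of \<open>C\<close> is
      at least 10 as well.\<close>
    then show ?thesis unfolding d_eq using dC \<delta>k k by simp
  qed

  have "2 ^ ((m + 1) div 2) + 2 = (10::nat)" if "m = 5" using that by simp
  then show ?thesis
    using gen_dual gen' cyclic_code_poly_code[OF n2 ggd_X] self_dual nkd d1 d5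
    unfolding C'[symmetric] k_def by simp
qed

end
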